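(* Let $\mathcal{P}$ be a chiral $n$-polytope such that $X(\mathcal{P})$ is infinite, and let $\mathcal{Q}$ be a finite chiral or directly regular $n$-polytope. Then $X(\mathcal{P}\diamond\mathcal{Q})$ is infinite.
   Context: All polytopes are abstract polytopes. A regular polytope is directly regular if its rotation group $\Gamma^+(\mathcal{P})$, generated by $\sigma_i=\rho_{i-1}\rho_i$ ($\rho_0,\dots,\rho_{n-1}$ the standard generating involutions relative to a base flag), has index $2$ in the automorphism group. A polytope is chiral if its automorphism group has two orbits on flags, adjacent flags lying in distinct orbits; then $\Gamma^+(\mathcal{P})$ is the full automorphism group, generated by standard rotations $\sigma_1,\dots,\sigma_{n-1}$. Let $W^+=\langle \sigma_1,\dots,\sigma_{n-1}\mid (\sigma_i\cdots\sigma_j)^2=1,\ 1\le i<j\le n-1\rangle$; each such $\Gamma^+(\mathcal{P})$ equals $W^+/M$ for a normal subgroup $M$, generators corresponding. Let $w\mapsto\overline{w}$ be the automorphism of $W^+$ with $\sigma_1\mapsto\sigma_1^{-1}$, $\sigma_2\mapsto\sigma_1^2\sigma_2$, $\sigma_j\mapsto\sigma_j$ ($j\ge3$). Mix: if $\Gamma^+(\mathcal{P})=W^+/M$ and $\Gamma^+(\mathcal{Q})=W^+/K$, the mix $\mathcal{P}\diamond\mathcal{Q}$ is the (flag-connected pre-)polytope whose rotation group is the subgroup of $\Gamma^+(\mathcal{P})\times\Gamma^+(\mathcal{Q})$ generated by $(\sigma_i,\sigma_i')$, isomorphic to $W^+/(M\cap K)$. Chirality group: for rotation group $W^+/N$,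 $X=N\overline{N}/N$, the kernel of the natural epimorphism $W^+/N\to W^+/(N\overline N)$ (isomorphic to $N/(N\cap\overline N)$). *)

theory Defs
  imports "HOL-Algebra.Group_Action" "HOL-Algebra.Generated_Groups"
begin

section \<open>Abstract polytopes\<close>

text \<open>A poset is given by its (reflexive) order relation; its faces are the elements of
  \<^term>\<open>Field r\<close>.\<close>

definition flags :: "'a rel \<Rightarrow> 'a set set" where
  "flags r = {\<Phi> \<in> Chains r. \<forall>\<Psi> \<in> Chains r. \<Phi> \<subseteq> \<Psi> \<longrightarrow> \<Psi> = \<Phi>}"

text \<open>Ranks start at \<open>-1\<close>. When all flags have the same finite number of faces, the number of
  faces below \<open>F\<close> does not depend on the chosen flag through \<open>F\<close>.\<close>

definition face_rank :: "'a rel \<Rightarrow> 'a \<Rightarrow> int" where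
  "face_rank r F = int (card ((SOME \<Phi>. \<Phi> \<in> flags r \<and> F \<in> \<Phi>) \<inter> underS r F)) - 1"

definition i_adjacent :: "'a rel \<Rightarrow> nat \<Rightarrow> 'a set \<Rightarrow> 'a set \<Rightarrow> bool" where
  "i_adjacent r i \<Phi> \<Psi> \<longleftrightarrow> \<Phi> \<in> flags r \<and> \<Psi> \<in> flags r \<and> \<Phi> \<noteq> \<Psi> \<and>
     {F \<in> \<Phi>. face_rank r F \<noteq> int i} = {F \<in> \<Psi>. face_rank r F \<noteq> int i}"

definition adjacent :: "'a rel \<Rightarrow> 'a set \<Rightarrow> 'a set \<Rightarrow> bool" where
  "adjacent r \<Phi> \<Psi> \<longleftrightarrow> (\<exists>i. i_adjacent r i \<Phi> \<Psi>)"

definition strongly_flag_connected :: "'a rel \<Rightarrow> bool" where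
  "strongly_flag_connected r \<longleftrightarrow>
     (\<forall>\<Phi> \<in> flags r. \<forall>\<Psi> \<in> flags r.
        (\<Phi>, \<Psi>) \<in> {(X, Y). adjacent r X Y \<and> \<Phi> \<inter> \<Psi> \<subseteq> X \<and> \<Phi> \<inter> \<Psi> \<subseteq> Y}\<^sup>*)"

definition abstract_polytope :: "nat \<Rightarrow> 'a rel \<Rightarrow> bool" where
  "abstract_polytope n r \<longleftrightarrow>
     Partial_order r \<and>
     (\<exists>F \<in> Field r. \<forall>G \<in> Field r. (F, G) \<in> r) \<and>
     (\<exists>F \<in> Field r. \<forall>G \<in> Field r. (G, F) \<in> r) \<and>
     (\<forall>\<Phi> \<in> flags r. card \<Phi> = n + 2) \<and>
     strongly_flag_connected r \<and>
     (\<forall>F G. (F, G) \<in> r \<and> face_rank r G = face_rank r F + 2 \<longrightarrow>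
        card {H. F \<in> underS r H \<and> H \<in> underS r G} = 2)"

text \<open>Automorphisms are extensional functions on the set of faces. They act from the left,
  \<open>(g \<otimes> h) x = g (h x)\<close>.\<close>

definition aut_group :: "'a rel \<Rightarrow> ('a \<Rightarrow> 'a) monoid" where
  "aut_group r = (BijGroup (Field r))
     \<lparr>carrier := {f \<in> Bij (Field r). \<forall>x \<in> Field r. \<forall>y \<in> Field r. (f x, f y) \<in> r \<longleftrightarrow> (x, y) \<in> r}\<rparr>"

abbreviation flag_action :: "('a \<Rightarrow> 'a) \<Rightarrow> 'a set \<Rightarrow> 'a set" where
  "flag_action f \<Phi> \<equiv> f ` \<Phi>"

definition regular_polytope :: "nat \<Rightarrow> 'a rel \<Rightarrow> bool" where
  "regular_polytope n r \<longleftrightarrow>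
     abstract_polytope n r \<and> card (orbits (aut_group r) (flags r) flag_action) = 1"

definition chiral_polytope :: "nat \<Rightarrow> 'a rel \<Rightarrow> bool" where
  "chiral_polytope n r \<longleftrightarrow>
     abstract_polytope n r \<and> card (orbits (aut_group r) (flags r) flag_action) = 2 \<and>
     (\<forall>\<Phi> \<Psi>. adjacent r \<Phi> \<Psi> \<longrightarrow>
        orbit (aut_group r) flag_action \<Phi> \<noteq> orbit (aut_group r) flag_action \<Psi>)"

text \<open>The flag \<open>\<Phi>\<^sup>i\<close>.\<close>

definition adj_flag :: "'a rel \<Rightarrow> nat \<Rightarrow> 'a set \<Rightarrow> 'a set" where
  "adj_flag r i \<Phi> = (THE \<Psi>. i_adjacent r i \<Phi> \<Psi>)"

definition aut_moving :: "'a rel \<Rightarrow> 'a set \<Rightarrow> 'a set \<Rightarrow> 'a \<Rightarrow> 'a" where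
  "aut_moving r \<Phi> \<Psi> = (THE f. f \<in> carrier (aut_group r) \<and> flag_action f \<Phi> = \<Psi>)"

definition rho :: "'a rel \<Rightarrow> 'a set \<Rightarrow> nat \<Rightarrow> 'a \<Rightarrow> 'a" where
  "rho r \<Phi> i = aut_moving r \<Phi> (adj_flag r i \<Phi>)"

text \<open>In the chiral case \<open>\<sigma>\<^sub>i\<close> is the automorphism that fixes the faces of the base flag of rank
  different from \<open>i - 1\<close> and \<open>i\<close> and sends the \<open>i\<close>-face of \<open>\<Phi>\<^sup>i\<close> to that of \<open>\<Phi>\<close>; hence it sends
  \<open>\<Phi>\<close> to \<open>(\<Phi>\<^bsup>i-1\<^esup>)\<^sup>i\<close>, as does \<open>\<rho>\<^bsub>i-1\<^esub> \<rho>\<^sub>i\<close> in the regular case.\<close>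

definition sigma :: "nat \<Rightarrow> 'a rel \<Rightarrow> 'a set \<Rightarrow> nat \<Rightarrow> 'a \<Rightarrow> 'a" where
  "sigma n r \<Phi> i =
     (if regular_polytope n r then rho r \<Phi> (i - 1) \<otimes>\<^bsub>aut_group r\<^esub> rho r \<Phi> i
      else aut_moving r \<Phi> (adj_flag r i (adj_flag r (i - 1) \<Phi>)))"

definition rotation_group :: "nat \<Rightarrow> 'a rel \<Rightarrow> 'a set \<Rightarrow> ('a \<Rightarrow> 'a) monoid" where
  "rotation_group n r \<Phi> = subgroup_generated (aut_group r) (sigma n r \<Phi> ` {1..<n})"

definition directly_regular_polytope :: "nat \<Rightarrow> 'a rel \<Rightarrow> bool" where
  "directly_regular_polytope n r \<longleftrightarrow>
     regular_polytope n r \<and>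
     (\<exists>\<Phi> \<in> flags r. card (rcosets\<^bsub>aut_group r\<^esub> (carrier (rotation_group n r \<Phi>))) = 2)"

section \<open>Groups given by generators and relators\<close>

text \<open>A letter is a generator paired with \<^term>\<open>True\<close>, or the inverse of a generator, paired
  with \<^term>\<open>False\<close>.\<close>

type_synonym 'g word = "('g \<times> bool) list"

definition words :: "'g set \<Rightarrow> 'g word set" where
  "words S = lists (S \<times> UNIV)"

definition word_step :: "'g set \<Rightarrow> 'g word set \<Rightarrow> 'g word rel" where
  "word_step S R = {(u @ w @ v, u @ v) | u v w. u \<in> words S \<and> v \<in> words S \<and>
     w \<in> R \<union> {[(g, b), (g, \<not> b)] | g b. g \<in> S}}"

definition word_equiv :: "'g set \<Rightarrow> 'g word set \<Rightarrow> 'g word rel" where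
  "word_equiv S R = (word_step S R \<union> (word_step S R)\<inverse>)\<^sup>* \<inter> words S \<times> words S"

definition presented_group :: "'g set \<Rightarrow> 'g word set \<Rightarrow> 'g word set monoid" where
  "presented_group S R =
     \<lparr>carrier = words S // word_equiv S R,
      mult = (\<lambda>X Y. \<Union>u \<in> X. \<Union>v \<in> Y. word_equiv S R `` {u @ v}),
      one = word_equiv S R `` {[]}\<rparr>"

definition word_eval :: "('b, 'm) monoid_scheme \<Rightarrow> ('g \<Rightarrow> 'b) \<Rightarrow> 'g word \<Rightarrow> 'b" where
  "word_eval G f w =
     foldr (\<lambda>(g, b) x. (if b then f g else inv\<^bsub>G\<^esub> (f g)) \<otimes>\<^bsub>G\<^esub> x) w \<one>\<^bsub>G\<^esub>"

text \<open>The homomorphism from a presented group to \<open>G\<close> extending \<open>f\<close>, provided \<open>f\<close> respects the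
  relators: then all words in a class \<open>X\<close> have the same value.\<close>

definition pres_hom :: "('b, 'm) monoid_scheme \<Rightarrow> ('g \<Rightarrow> 'b) \<Rightarrow> 'g word set \<Rightarrow> 'b" where
  "pres_hom G f X = the_elem (word_eval G f ` X)"

section \<open>The group \<open>W\<^sup>+\<close>, the mix and chirality groups\<close>

definition Wplus_relators :: "nat \<Rightarrow> nat word set" where
  "Wplus_relators n = {w @ w | w i j. 1 \<le> i \<and> i < j \<and> j \<le> n - 1 \<and>
     w = map (\<lambda>k. (k, True)) [i..<Suc j]}"

definition Wplus :: "nat \<Rightarrow> nat word set monoid" where
  "Wplus n = presented_group {1..<n} (Wplus_relators n)"

definition Wplus_gen :: "nat \<Rightarrow> nat \<Rightarrow> nat word set" where
  "Wplus_gen n i = word_equiv {1..<n} (Wplus_relators n) `` {[(i, True)]}"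

definition Wplus_bar :: "nat \<Rightarrow> nat word set \<Rightarrow> nat word set" where
  "Wplus_bar n = pres_hom (Wplus n)
     (\<lambda>i. if i = 1 then inv\<^bsub>Wplus n\<^esub> (Wplus_gen n 1)
          else if i = 2 then (Wplus_gen n 1 [^]\<^bsub>Wplus n\<^esub> (2::nat)) \<otimes>\<^bsub>Wplus n\<^esub> Wplus_gen n 2
          else Wplus_gen n i)"

text \<open>The normal subgroup \<open>N\<close> such that a group \<open>G\<close> with generators \<open>s 1, \<dots>, s (n - 1)\<close> is
  \<open>W\<^sup>+/N\<close>, generators corresponding.\<close>

definition Wplus_kernel :: "nat \<Rightarrow> ('b, 'm) monoid_scheme \<Rightarrow> (nat \<Rightarrow> 'b) \<Rightarrow> nat word set set" where
  "Wplus_kernel n G s = kernel (Wplus n) G (pres_hom G s)"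

text \<open>\<open>N\<close> and its image under the bar automorphism are normal, so their set product is the
  subgroup generated by both.\<close>

definition chirality_group ::
    "nat \<Rightarrow> ('b, 'm) monoid_scheme \<Rightarrow> (nat \<Rightarrow> 'b) \<Rightarrow> nat word set set monoid" where
  "chirality_group n G s =
     (let N = Wplus_kernel n G s
      in (Wplus n)\<lparr>carrier := N <#>\<^bsub>Wplus n\<^esub> (Wplus_bar n ` N)\<rparr> Mod N)"

definition polytope_chirality_group :: "nat \<Rightarrow> 'a rel \<Rightarrow> 'a set \<Rightarrow> nat word set set monoid" where
  "polytope_chirality_group n r \<Phi> = chirality_group n (rotation_group n r \<Phi>) (sigma n r \<Phi>)"

text \<open>The mix of two polytopes with base flags enters only through its rotation group and the
  standard generators of that group (it need not be a polytope).\<close>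

definition mix_sigma ::
    "nat \<Rightarrow> 'a rel \<Rightarrow> 'a set \<Rightarrow> 'b rel \<Rightarrow> 'b set \<Rightarrow> nat \<Rightarrow> ('a \<Rightarrow> 'a) \<times> ('b \<Rightarrow> 'b)" where
  "mix_sigma n r \<Phi> s \<Psi> i = (sigma n r \<Phi> i, sigma n s \<Psi> i)"

definition mix_rotation_group ::
    "nat \<Rightarrow> 'a rel \<Rightarrow> 'a set \<Rightarrow> 'b rel \<Rightarrow> 'b set \<Rightarrow> (('a \<Rightarrow> 'a) \<times> ('b \<Rightarrow> 'b)) monoid" where
  "mix_rotation_group n r \<Phi> s \<Psi> =
     subgroup_generated (rotation_group n r \<Phi> \<times>\<times> rotation_group n s \<Psi>)
       (mix_sigma n r \<Phi> s \<Psi> ` {1..<n})"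

definition mix_chirality_group ::
    "nat \<Rightarrow> 'a rel \<Rightarrow> 'a set \<Rightarrow> 'b rel \<Rightarrow> 'b set \<Rightarrow> nat word set set monoid" where
  "mix_chirality_group n r \<Phi> s \<Psi> =
     chirality_group n (mix_rotation_group n r \<Phi> s \<Psi>) (mix_sigma n r \<Phi> s \<Psi>)"

end

theory Submission
  imports Defs
begin

text \<open>Let \<open>M\<close> and \<open>K\<close> be the kernels of the maps from \<open>W\<^sup>+\<close> onto the two rotation groups, so that
  the mix has kernel \<open>L = M \<inter> K\<close>. Since \<open>K\<close> has finite index, so does \<open>L\<close> in \<open>M\<close>, and \<open>M\<close> is a
  finite union of cosets \<open>L m\<close>. The elements of the chirality groups are the cosets \<open>M b\<close> and \<open>L b\<close>
  with \<open>b\<close> in the bar images of \<open>M\<close> and \<open>L\<close>, so if the images of \<open>L\<close> lay in finitely many cosets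
  of \<open>L\<close>, then the images of \<open>M\<close> would lie in finitely many cosets of \<open>M\<close>. That the rotation groups
  are quotients of \<open>W\<^sup>+\<close> holds because an automorphism is determined by its value on one flag and
  \<open>\<sigma>\<^sub>i \<cdots> \<sigma>\<^sub>j\<close> sends the base flag \<open>\<Phi>\<close> to \<open>(\<Phi>\<^bsup>i-1\<^esup>)\<^sup>j\<close>.\<close>

section \<open>Groups given by generators and relators\<close>

lemma words_append [simp]: "u @ v \<in> words S \<longleftrightarrow> u \<in> words S \<and> v \<in> words S"
  by (auto simp: words_def)

lemma words_Nil [simp]: "[] \<in> words S"
  by (simp add: words_def)

lemma words_Cons [simp]: "x # w \<in> words S \<longleftrightarrow> fst x \<in> S \<and> w \<in> words S"
  by (cases x) (auto simp: words_def)

lemma word_step_context: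
  assumes "(x, y) \<in> word_step S R" "u \<in> words S" "v \<in> words S"
  shows "(u @ x @ v, u @ y @ v) \<in> word_step S R"
proof -
  obtain a w b where "x = a @ w @ b" "y = a @ b" "a \<in> words S" "b \<in> words S"
    "w \<in> R \<union> {[(g, b), (g, \<not> b)] | g b. g \<in> S}"
    using assms(1) unfolding word_step_def by blast
  moreover have "u @ x @ v = (u @ a) @ w @ (b @ v)" "u @ y @ v = (u @ a) @ (b @ v)"
    using calculation by auto
  moreover have "u @ a \<in> words S" "b @ v \<in> words S"
    using assms(2,3) calculation by simp_all
  ultimately show ?thesis
    unfolding word_step_def by blast
qed

lemma word_equiv_context:
  assumes "(x, y) \<in> word_equiv S R" "u \<in> words S" "v \<in> words S"
  shows "(u @ x @ v, u @ y @ v) \<in> word_equiv S R"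
proof -
  have "(x, y) \<in> (word_step S R \<union> (word_step S R)\<inverse>)\<^sup>*" and xy: "x \<in> words S" "y \<in> words S"
    using assms(1) by (auto simp: word_equiv_def)
  from this(1) have "(u @ x @ v, u @ y @ v) \<in> (word_step S R \<union> (word_step S R)\<inverse>)\<^sup>*"
  proof induction
    case (step y z)
    then show ?case
      using word_step_context[OF _ assms(2,3)] by (auto intro: rtrancl_into_rtrancl)
  qed simp
  then show ?thesis
    using assms(2,3) xy by (simp add: word_equiv_def)
qed

lemma equiv_word_equiv: "equiv (words S) (word_equiv S R)"
proof (rule equivI)
  have "sym ((word_step S R \<union> (word_step S R)\<inverse>)\<^sup>*)"
    by (intro sym_rtrancl sym_Un_converse)
  then show "sym (word_equiv S R)"
    unfolding word_equiv_def by (auto simp: sym_def)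
  show "trans (word_equiv S R)"
    unfolding word_equiv_def by (auto simp: trans_def)
qed (auto simp: word_equiv_def refl_on_def)

text \<open>The two factors are changed one after the other, each with the other as context. This
  congruence property is what makes the product of classes well defined.\<close>

lemma word_equiv_append:
  assumes "(u, u') \<in> word_equiv S R" "(v, v') \<in> word_equiv S R"
  shows "(u @ v, u' @ v') \<in> word_equiv S R"
proof -
  have "u' \<in> words S" "v \<in> words S"
    using assms by (auto simp: word_equiv_def)
  then have "(u @ v, u' @ v) \<in> word_equiv S R" "(u' @ v, u' @ v') \<in> word_equiv S R"
    using word_equiv_context[OF assms(1), of "[]" v] word_equiv_context[OF assms(2), of u' "[]"]
    by auto
  then show ?thesis
    using equiv_word_equiv[of S R] by (meson equivE transD)
qed

lemma word_step_imp_equiv: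
  assumes "(x, y) \<in> word_step S R" "x \<in> words S" "y \<in> words S"
  shows "(x, y) \<in> word_equiv S R"
  using assms by (auto simp: word_equiv_def)

section \<open>The group of word classes\<close>

abbreviation word_class :: "'g set \<Rightarrow> 'g word set \<Rightarrow> 'g word \<Rightarrow> 'g word set" where
  "word_class S R w \<equiv> word_equiv S R `` {w}"

lemma word_class_eq_iff:
  "u \<in> words S \<Longrightarrow> v \<in> words S \<Longrightarrow>
    word_class S R u = word_class S R v \<longleftrightarrow> (u, v) \<in> word_equiv S R"
  by (rule eq_equiv_class_iff[OF equiv_word_equiv])

lemma mem_word_class: "u \<in> words S \<Longrightarrow> u \<in> word_class S R u"
  by (rule equiv_class_self[OF equiv_word_equiv])

lemma carrier_presented_group:
  "carrier (presented_group S R) = word_class S R ` words S"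
  by (auto simp: presented_group_def quotient_def)

lemma one_presented_group: "\<one>\<^bsub>presented_group S R\<^esub> = word_class S R []"
  by (simp add: presented_group_def)

text \<open>By congruence all classes \<open>word_class S R (u' @ v')\<close> in the defining union
  coincide, so the union collapses to a single class.\<close>

lemma mult_presented_group:
  assumes "u \<in> words S" "v \<in> words S"
  shows "word_class S R u \<otimes>\<^bsub>presented_group S R\<^esub> word_class S R v = word_class S R (u @ v)"
proof -
  have "(\<Union>u'\<in>word_class S R u. \<Union>v'\<in>word_class S R v. word_class S R (u' @ v'))
      = word_class S R (u @ v)"
  proof (rule equalityI)
    have "word_class S R (u' @ v') = word_class S R (u @ v)"
      if "u' \<in> word_class S R u" "v' \<in> word_class S R v" for u' v'
      using that word_equiv_append[of u u' S R v v'] equiv_class_eq[OF equiv_word_equiv]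
      by (metis Image_singleton_iff)
    then show "(\<Union>u'\<in>word_class S R u. \<Union>v'\<in>word_class S R v. word_class S R (u' @ v'))
        \<subseteq> word_class S R (u @ v)"
      by (intro UN_least) (rule equalityD1)
    show "word_class S R (u @ v)
        \<subseteq> (\<Union>u'\<in>word_class S R u. \<Union>v'\<in>word_class S R v. word_class S R (u' @ v'))"
      by (rule subset_trans[OF UN_upper[OF mem_word_class[OF assms(2)]]
            UN_upper[OF mem_word_class[OF assms(1)]]])
  qed
  then show ?thesis
    unfolding presented_group_def by (simp only: monoid.simps)
qed

definition word_inv :: "'g word \<Rightarrow> 'g word" where
  "word_inv w = rev (map (\<lambda>(g, b). (g, \<not> b)) w)"

lemma word_inv_words: "w \<in> words S \<Longrightarrow> word_inv w \<in> words S"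
  unfolding words_def word_inv_def by (induction w) auto

text \<open>Cancellation starts in the middle: \<open>word_inv (x # w)\<close> ends with the inverse
  of \<open>x\<close>, and deleting this pair leaves \<open>word_inv w @ w\<close>.\<close>

lemma word_inv_cancel:
  assumes "w \<in> words S"
  shows "(word_inv w @ w, []) \<in> word_equiv S R"
  using assms
proof (induction w)
  case Nil
  then show ?case by (simp add: word_equiv_def word_inv_def)
next
  case (Cons x w)
  obtain g b where x: "x = (g, b)" by fastforce
  have w: "w \<in> words S" "g \<in> S" using Cons.prems x by auto
  have iw: "word_inv w \<in> words S" using w by (simp add: word_inv_words)
  \<comment> \<open>The pair begins with the negated flag, so it is a free cancellation for the
    letter \<open>(g, \<not> b)\<close>.\<close>
  have "[(g, \<not> b), (g, b)] = [(g, \<not> b), (g, \<not> (\<not> b))]" by simp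
  then have "[(g, \<not> b), (g, b)] \<in> {[(g, b), (g, \<not> b)] | g b. g \<in> S}"
    using w(2) by blast
  then have "(word_inv w @ [(g, \<not> b), (g, b)] @ w, word_inv w @ w) \<in> word_step S R"
    unfolding word_step_def using w iw by blast
  then have "(word_inv (x # w) @ x # w, word_inv w @ w) \<in> word_equiv S R"
    by (intro word_step_imp_equiv) (use w iw x in \<open>auto simp: word_inv_def\<close>)
  with Cons.IH[OF w(1)] show ?case
    using equiv_word_equiv[of S R] by (meson equivE transD)
qed

lemma group_presented_group: "group (presented_group S R)"
proof (rule groupI)
  fix x assume "x \<in> carrier (presented_group S R)"
  then obtain u where u: "u \<in> words S" "x = word_class S R u"
    by (auto simp: carrier_presented_group)
  then have "word_class S R (word_inv u) \<otimes>\<^bsub>presented_group S R\<^esub> x = \<one>\<^bsub>presented_group S R\<^esub>"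
    by (simp add: mult_presented_group word_inv_words one_presented_group word_class_eq_iff
        word_inv_cancel)
  then show "\<exists>y\<in>carrier (presented_group S R).
      y \<otimes>\<^bsub>presented_group S R\<^esub> x = \<one>\<^bsub>presented_group S R\<^esub>"
    using u by (auto simp: carrier_presented_group word_inv_words)
next
  fix x y assume "x \<in> carrier (presented_group S R)" "y \<in> carrier (presented_group S R)"
  then obtain u v where "u \<in> words S" "x = word_class S R u" "v \<in> words S" "y = word_class S R v"
    by (auto simp: carrier_presented_group)
  then show "x \<otimes>\<^bsub>presented_group S R\<^esub> y \<in> carrier (presented_group S R)"
    by (simp add: mult_presented_group carrier_presented_group)
  fix z assume "z \<in> carrier (presented_group S R)"
  then obtain w where "w \<in> words S" "z = word_class S R w"
    by (auto simp: carrier_presented_group)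
  then show "x \<otimes>\<^bsub>presented_group S R\<^esub> y \<otimes>\<^bsub>presented_group S R\<^esub> z =
      x \<otimes>\<^bsub>presented_group S R\<^esub> (y \<otimes>\<^bsub>presented_group S R\<^esub> z)"
    using \<open>u \<in> words S\<close> \<open>x = word_class S R u\<close> \<open>v \<in> words S\<close> \<open>y = word_class S R v\<close>
    by (simp add: mult_presented_group)
next
  fix x assume "x \<in> carrier (presented_group S R)"
  then obtain u where "u \<in> words S" "x = word_class S R u"
    by (auto simp: carrier_presented_group)
  then show "\<one>\<^bsub>presented_group S R\<^esub> \<otimes>\<^bsub>presented_group S R\<^esub> x = x"
    by (simp add: one_presented_group mult_presented_group)
qed (simp add: one_presented_group carrier_presented_group)

section \<open>Evaluation of words and the induced homomorphism\<close>

lemma word_eval_Nil [simp]: "word_eval G f [] = \<one>\<^bsub>G\<^esub>"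
  by (simp add: word_eval_def)

lemma word_eval_Cons [simp]:
  "word_eval G f ((g, b) # w) = (if b then f g else inv\<^bsub>G\<^esub> (f g)) \<otimes>\<^bsub>G\<^esub> word_eval G f w"
  by (simp add: word_eval_def)

context group
begin

lemma word_eval_closed:
  assumes "f \<in> S \<rightarrow> carrier G" "w \<in> words S"
  shows "word_eval G f w \<in> carrier G"
  using assms(2)
proof (induction w)
  case (Cons x w)
  then show ?case using assms(1) by (cases x) (auto simp: Pi_iff)
qed simp

lemma word_eval_append:
  assumes "f \<in> S \<rightarrow> carrier G" "u \<in> words S" "v \<in> words S"
  shows "word_eval G f (u @ v) = word_eval G f u \<otimes> word_eval G f v"
  using assms(2)
proof (induction u)
  case (Cons x u)
  then show ?case using assms word_eval_closed[OF assms(1)]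
    by (cases x) (auto simp: Pi_iff m_assoc)
qed (simp add: word_eval_closed[OF assms(1)] assms)

lemma word_eval_hom:
  assumes "group H" "h \<in> hom G H" "f \<in> S \<rightarrow> carrier G" "w \<in> words S"
  shows "h (word_eval G f w) = word_eval H (h \<circ> f) w"
proof -
  interpret h: group_hom G H h
    using assms is_group by (simp add: group_hom_def group_hom_axioms_def)
  show ?thesis
    using assms(4)
  proof (induction w)
    case (Cons x w)
    then show ?case using assms(3) word_eval_closed[OF assms(3)]
      by (cases x) (auto simp: Pi_iff)
  qed simp
qed

text \<open>A step deletes a relator or a pair of inverse letters, and both evaluate to the
  identity.\<close>

lemma word_eval_equiv:
  assumes f: "f \<in> S \<rightarrow> carrier G" and R: "R \<subseteq> words S" "\<And>w. w \<in> R \<Longrightarrow> word_eval G f w = \<one>"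
    and uv: "(u, v) \<in> word_equiv S R"
  shows "word_eval G f u = word_eval G f v"
proof -
  have step: "word_eval G f x = word_eval G f y" if "(x, y) \<in> word_step S R" for x y
  proof -
    obtain a w b where xy: "x = a @ w @ b" "y = a @ b" "a \<in> words S" "b \<in> words S"
      and w: "w \<in> R \<union> {[(g, b), (g, \<not> b)] | g b. g \<in> S}"
      using \<open>(x, y) \<in> word_step S R\<close> unfolding word_step_def by blast
    have "w \<in> words S \<and> word_eval G f w = \<one>"
      using w R f by (auto simp: Pi_iff r_inv l_inv)
    then show ?thesis
      using xy f word_eval_closed[OF f] by (simp add: word_eval_append[where S = S])
  qed
  have "(u, v) \<in> (word_step S R \<union> (word_step S R)\<inverse>)\<^sup>*"
    using uv by (simp add: word_equiv_def)
  then show ?thesis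
    by induction (use step in force)+
qed

text \<open>Evaluation is constant on a class, so the image is a singleton and
  \<open>the_elem\<close> picks its member.\<close>

lemma pres_hom_word_class:
  assumes "f \<in> S \<rightarrow> carrier G" "R \<subseteq> words S" "\<And>w. w \<in> R \<Longrightarrow> word_eval G f w = \<one>"
    and "u \<in> words S"
  shows "pres_hom G f (word_class S R u) = word_eval G f u"
proof -
  have "word_eval G f v = word_eval G f u" if "v \<in> word_class S R u" for v
    using word_eval_equiv[OF assms(1-3), of u v] that by simp
  then have "word_eval G f ` word_class S R u = {word_eval G f u}"
    using mem_word_class[OF assms(4), of R] by (blast intro: sym)
  then show ?thesis
    by (simp add: pres_hom_def)
qed

lemma pres_hom_hom:
  assumes "f \<in> S \<rightarrow> carrier G" "R \<subseteq> words S" "\<And>w. w \<in> R \<Longrightarrow> word_eval G f w = \<one>"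
  shows "pres_hom G f \<in> hom (presented_group S R) G"
  using assms
  by (auto intro!: homI simp: carrier_presented_group pres_hom_word_class mult_presented_group
      word_eval_closed word_eval_append[where S = S])

end

text \<open>Induction on the word; the one point to check is that a letter paired with
  \<open>False\<close> represents the inverse of the generator's class. Evaluation in the presented
  group thereby becomes a question about words.\<close>

lemma word_eval_presented_group:
  assumes "w \<in> words S"
  shows "word_eval (presented_group S R) (\<lambda>g. word_class S R [(g, True)]) w = word_class S R w"
  using assms
proof (induction w)
  case Nil
  then show ?case by (simp add: one_presented_group)
next
  case (Cons x w)
  obtain g b where x: "x = (g, b)" by fastforce
  with Cons.prems have g: "g \<in> S" and w: "w \<in> words S" by auto
  interpret group "presented_group S R" by (rule group_presented_group)
  have "word_class S R [(g, False)] \<otimes>\<^bsub>presented_group S R\<^esub> word_class S R [(g, True)]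
      = \<one>\<^bsub>presented_group S R\<^esub>"
    using word_inv_cancel[of "[(g, True)]" S R] g
    by (simp add: mult_presented_group one_presented_group word_class_eq_iff word_inv_def)
  then have "inv\<^bsub>presented_group S R\<^esub> (word_class S R [(g, True)]) = word_class S R [(g, False)]"
    using g by (intro inv_equality) (auto simp: carrier_presented_group)
  then have "(if b then word_class S R [(g, True)]
      else inv\<^bsub>presented_group S R\<^esub> (word_class S R [(g, True)])) = word_class S R [(g, b)]"
    by simp
  then show ?case
    using x g w Cons.IH[OF w] mult_presented_group[of "[(g, b)]" S w R] by simp
qed

section \<open>The group \<open>W\<^sup>+\<close> and its bar automorphism\<close>

lemma Wplus_relators_words: "Wplus_relators n \<subseteq> words {1..<n}"
proof
  fix u assume "u \<in> Wplus_relators n"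
  then obtain i j where "1 \<le> i" "i < j" "j \<le> n - 1" "u = map (\<lambda>k. (k, True)) [i..<Suc j] @ map (\<lambda>k. (k, True)) [i..<Suc j]"
    unfolding Wplus_relators_def by blast
  \<comment> \<open>From \<open>1 \<le> i\<close> and \<open>i < j\<close> it follows that
    \<open>j\<close> is at least 2, so \<open>n - 1\<close> is not truncated.\<close>
  moreover have "j < n" using calculation by linarith
  ultimately show "u \<in> words {1..<n}"
    by (auto simp: words_def simp del: upt_Suc)
qed

lemma group_Wplus: "group (Wplus n)"
  by (simp add: Wplus_def group_presented_group)

lemma Wplus_gen_closed: "i \<in> {1..<n} \<Longrightarrow> Wplus_gen n i \<in> carrier (Wplus n)"
  by (auto simp: Wplus_def Wplus_gen_def carrier_presented_group)

abbreviation run_word :: "nat \<Rightarrow> nat \<Rightarrow> nat word" where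
  "run_word i j \<equiv> map (\<lambda>k. (k, True)) [i..<Suc j]"

lemma run_word_words: "1 \<le> i \<Longrightarrow> j < n \<Longrightarrow> run_word i j \<in> words {1..<n}"
  by (auto simp: words_def)

lemma Wplus_relator_run:
  assumes "1 \<le> i" "i < j" "j < n"
  shows "word_eval (Wplus n) (Wplus_gen n) (run_word i j) \<otimes>\<^bsub>Wplus n\<^esub>
    word_eval (Wplus n) (Wplus_gen n) (run_word i j) = \<one>\<^bsub>Wplus n\<^esub>"
proof -
  let ?w = "run_word i j"
  have w: "?w \<in> words {1..<n}" using assms run_word_words by blast
  have ev: "word_eval (Wplus n) (Wplus_gen n) u = word_class {1..<n} (Wplus_relators n) u"
    if "u \<in> words {1..<n}" for u
    using word_eval_presented_group[OF that, of "Wplus_relators n"]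
    unfolding Wplus_def Wplus_gen_def .
  have "?w @ ?w \<in> Wplus_relators n"
    unfolding Wplus_relators_def mem_Collect_eq using assms
    by (intro exI[of _ ?w] exI[of _ i] exI[of _ j] conjI refl) simp_all
  then have "([] @ (?w @ ?w) @ [], [] @ []) \<in> word_step {1..<n} (Wplus_relators n)"
    unfolding word_step_def using words_Nil by blast
  then have "(?w @ ?w, []) \<in> word_equiv {1..<n} (Wplus_relators n)"
    using w by (intro word_step_imp_equiv) simp_all
  then show ?thesis
    using w unfolding ev[OF w] unfolding Wplus_def
    by (simp add: mult_presented_group one_presented_group word_class_eq_iff del: upt_Suc)
qed

text \<open>Every relator is a run written twice, so it suffices that the value of each run squares
  to the identity.\<close>

lemma word_eval_relators:
  assumes "group G" "f \<in> {1..<n} \<rightarrow> carrier G"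
    and "\<And>i j. 1 \<le> i \<Longrightarrow> i < j \<Longrightarrow> j < n \<Longrightarrow>
      word_eval G f (run_word i j) \<otimes>\<^bsub>G\<^esub> word_eval G f (run_word i j) = \<one>\<^bsub>G\<^esub>"
    and "w \<in> Wplus_relators n"
  shows "word_eval G f w = \<one>\<^bsub>G\<^esub>"
proof -
  interpret group G by fact
  obtain i j where ij: "1 \<le> i" "i < j" "j \<le> n - 1" "w = run_word i j @ run_word i j"
    using assms(4) unfolding Wplus_relators_def by blast
  then have "run_word i j \<in> words {1..<n}"
    by (intro run_word_words) auto
  with ij assms(3)[of i j] show ?thesis
    by (simp add: word_eval_append[OF assms(2)] del: upt_Suc)
qed

lemma word_eval_cong:
  assumes "\<And>g. g \<in> S \<Longrightarrow> f g = h g" "w \<in> words S"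
  shows "word_eval G f w = word_eval G h w"
  using assms(2)
proof (induction w)
  case (Cons x w)
  then show ?case using assms(1) by (cases x) auto
qed simp

text \<open>It suffices that the images of the generators satisfy the relators. The images of the
  first two generators multiply to \<open>g 1 * g 2\<close>, so runs from 1 keep their value; runs
  from 3 or later involve only fixed generators; runs from 2 need a computation.\<close>

lemma Wplus_bar_hom: "Wplus_bar n \<in> hom (Wplus n) (Wplus n)"
proof -
  let ?W = "Wplus n" and ?g = "Wplus_gen n"
  interpret W: group ?W by (rule group_Wplus)
  define f where "f = (\<lambda>i. if i = 1 then inv\<^bsub>?W\<^esub> (?g 1)
          else if i = 2 then (?g 1 [^]\<^bsub>?W\<^esub> (2::nat)) \<otimes>\<^bsub>?W\<^esub> ?g 2 else ?g i)"
  have g: "?g \<in> {1..<n} \<rightarrow> carrier ?W"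
    using Wplus_gen_closed by auto
  then have f: "f \<in> {1..<n} \<rightarrow> carrier ?W"
    by (auto simp: f_def Pi_iff)
  have "word_eval ?W f (run_word i j) \<otimes>\<^bsub>?W\<^esub> word_eval ?W f (run_word i j) = \<one>\<^bsub>?W\<^esub>"
    if ij: "1 \<le> i" "i < j" "j < n" for i j
  proof -
    have tail: "word_eval ?W f (run_word k j) = word_eval ?W ?g (run_word k j)" if "k \<ge> 3" for k
      by (rule word_eval_cong[where S = "{k..}"])
        (use that in \<open>auto simp: f_def words_def\<close>)
    have split_run: "run_word k j = (k, True) # run_word (Suc k) j" if "k \<le> j" for k
      using that by (simp add: upt_rec)
    \<comment> \<open>The common tail of the runs from 1 and from 2; for \<open>j = 2\<close> it is
      the empty run with value one.\<close>
    define T where "T = word_eval ?W ?g (run_word 3 j)"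
    have g12: "?g 1 \<in> carrier ?W" "?g 2 \<in> carrier ?W"
      using ij Wplus_gen_closed by auto
    have T: "T \<in> carrier ?W"
      unfolding T_def by (rule W.word_eval_closed[OF g]) (use ij run_word_words in simp)
    have r1: "run_word 1 j = (1, True) # (2, True) # run_word 3 j"
      using split_run[of 1] split_run[of 2] ij by (simp add: numeral_2_eq_2 numeral_3_eq_3)
    have r2: "run_word 2 j = (2, True) # run_word 3 j"
      using split_run[of 2] ij by (simp add: numeral_3_eq_3)
    have f12: "f 1 = inv\<^bsub>?W\<^esub> (?g 1)" "f 2 = ?g 1 \<otimes>\<^bsub>?W\<^esub> (?g 1 \<otimes>\<^bsub>?W\<^esub> ?g 2)"
      using g12 by (simp_all add: f_def numeral_2_eq_2 W.m_assoc)
    have e1: "word_eval ?W f (run_word 1 j) = word_eval ?W ?g (run_word 1 j)"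
      unfolding r1 using g12 T
      by (simp add: f12 tail T_def[symmetric] W.m_assoc W.inv_solve_left' del: upt_Suc One_nat_def)
    define A where "A = word_eval ?W ?g (run_word 1 j)"
    define B where "B = word_eval ?W ?g (run_word 2 j)"
    have AB: "A \<in> carrier ?W" "B \<in> carrier ?W" "A = ?g 1 \<otimes>\<^bsub>?W\<^esub> B" "B = ?g 2 \<otimes>\<^bsub>?W\<^esub> T"
      unfolding A_def B_def r1 r2 using g12 T by (simp_all add: T_def del: upt_Suc One_nat_def)
    consider "i = 1" | "i = 2" | "i \<ge> 3" using ij by linarith
    then show ?thesis
    proof cases
      case 1
      then show ?thesis using e1 Wplus_relator_run[OF ij] by simp
    next
      case 2
      have A2: "A \<otimes>\<^bsub>?W\<^esub> A = \<one>\<^bsub>?W\<^esub>" and B2: "B \<otimes>\<^bsub>?W\<^esub> B = \<one>\<^bsub>?W\<^esub>"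
        unfolding A_def B_def using ij 2
        by (intro Wplus_relator_run; simp)+
      \<comment> \<open>As \<open>B\<close> is its own inverse, \<open>A = g 1 * B\<close> gives
        \<open>g 1 = A * B\<close>. The image of the run from 2 is then
        \<open>g 1 * A = A * B * A\<close>, a conjugate of the involution \<open>B\<close>.\<close>
      have "?g 1 = A \<otimes>\<^bsub>?W\<^esub> B"
        using AB g12 B2 by (simp add: W.m_assoc)
      moreover have "word_eval ?W f (run_word 2 j) = ?g 1 \<otimes>\<^bsub>?W\<^esub> A"
        unfolding r2 using g12 T AB
        by (simp add: f12 tail T_def[symmetric] W.m_assoc del: upt_Suc One_nat_def)
      ultimately have "word_eval ?W f (run_word 2 j) \<otimes>\<^bsub>?W\<^esub> word_eval ?W f (run_word 2 j)
          = A \<otimes>\<^bsub>?W\<^esub> B \<otimes>\<^bsub>?W\<^esub> (A \<otimes>\<^bsub>?W\<^esub> A) \<otimes>\<^bsub>?W\<^esub> B \<otimes>\<^bsub>?W\<^esub> A"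
        using AB(1,2) by (simp add: W.m_assoc del: upt_Suc One_nat_def)
      also have "\<dots> = A \<otimes>\<^bsub>?W\<^esub> (B \<otimes>\<^bsub>?W\<^esub> B) \<otimes>\<^bsub>?W\<^esub> A"
        using AB(1,2) by (simp add: A2 W.m_assoc)
      also have "\<dots> = \<one>\<^bsub>?W\<^esub>"
        using AB(1,2) by (simp add: A2 B2)
      finally show ?thesis using 2 by simp
    next
      case 3
      then show ?thesis using tail Wplus_relator_run[OF ij] by simp
    qed
  qed
  from word_eval_relators[OF group_Wplus f this] have "pres_hom ?W f \<in> hom ?W ?W"
    using W.pres_hom_hom[OF f Wplus_relators_words] by (simp add: Wplus_def)
  then show ?thesis
    by (simp add: Wplus_bar_def f_def)
qed

text \<open>A left factor from \<open>N\<close> is absorbed by the coset, so representatives from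
  \<open>B\<close> already give all cosets.\<close>

lemma (in group) carrier_set_mult_FactGroup:
  assumes "subgroup N G" "B \<subseteq> carrier G"
  shows "carrier (G\<lparr>carrier := N <#> B\<rparr> Mod N) = (\<lambda>x. N #> x) ` B"
proof -
  have N: "N \<subseteq> carrier G" using assms(1) by (rule subgroup.subset)
  have *: "N #> (x \<otimes> b) = N #> b" if "x \<in> N" "b \<in> B" for x b
  proof -
    have "x \<in> carrier G" "b \<in> carrier G" using that N assms(2) by auto
    then have "N #> (x \<otimes> b) = (N #> x) #> b"
      using N by (simp add: coset_mult_assoc)
    also have "N #> x = N"
      using \<open>x \<in> carrier G\<close> assms(1) \<open>x \<in> N\<close> by (rule coset_join2)
    finally show ?thesis .
  qed
  have "carrier (G\<lparr>carrier := N <#> B\<rparr> Mod N) = (\<lambda>x. N #> x) ` (N <#> B)"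
    by (simp add: carrier_FactGroup r_coset_def)
  also have "\<dots> = (\<lambda>x. N #> x) ` B"
  proof (intro equalityI subsetI)
    fix c assume "c \<in> (\<lambda>x. N #> x) ` (N <#> B)"
    then show "c \<in> (\<lambda>x. N #> x) ` B"
      using * by (auto simp: set_mult_def)
  next
    fix c assume "c \<in> (\<lambda>x. N #> x) ` B"
    then obtain b where b: "b \<in> B" "c = N #> b" by blast
    then have "b = \<one> \<otimes> b" using assms(2) by auto
    then have "b \<in> N <#> B"
      using b subgroup.one_closed[OF assms(1)] unfolding set_mult_def by blast
    then show "c \<in> (\<lambda>x. N #> x) ` (N <#> B)" using b by blast
  qed
  finally show ?thesis .
qed

text \<open>If \<open>L = M \<inter> ker k\<close> has finite index in \<open>M\<close>, then \<open>M\<close> is a finite union of sets \<open>L m\<close>, and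
  \<open>M b(l m) = M (L b(l)) b(m)\<close>.\<close>

lemma (in group) finite_cosets_image_mono_index:
  assumes M: "subgroup M G" and b: "b \<in> hom G G"
    and k: "k \<in> hom G H" "group H" "finite (k ` M)"
    and fin: "finite ((\<lambda>x. (M \<inter> kernel G H k) #> b x) ` (M \<inter> kernel G H k))"
  shows "finite ((\<lambda>x. M #> b x) ` M)"
proof -
  let ?L = "M \<inter> kernel G H k"
  interpret k: group_hom G H k
    using k is_group by (simp add: group_hom_def group_hom_axioms_def)
  have L: "subgroup ?L G"
    using M k.subgroup_kernel by (rule subgroups_Inter_pair)
  have MG: "M \<subseteq> carrier G" and LG: "?L \<subseteq> carrier G"
    using M L by (auto dest: subgroup.subset)
  have bG: "b x \<in> carrier G" if "x \<in> carrier G" for x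
    using b that by (rule hom_in_carrier)
  define m where "m = inv_into M k"
  have "(\<lambda>x. M #> b x) ` M
      \<subseteq> (\<lambda>(C, c). (M <#> C) #> b (m c)) ` ((\<lambda>x. ?L #> b x) ` ?L \<times> k ` M)"
  proof (rule image_subsetI)
    fix x assume x: "x \<in> M"
    define y where "y = m (k x)"
    define l where "l = x \<otimes> inv y"
    have y: "y \<in> M" "k y = k x"
      using x by (auto simp: y_def m_def inv_into_into f_inv_into_f)
    have xy: "x \<in> carrier G" "y \<in> carrier G" using x y MG by auto
    have "k l = \<one>\<^bsub>H\<^esub>"
      using xy y by (simp add: l_def)
    moreover have "l \<in> M"
      using M x y by (simp add: l_def subgroup.m_closed subgroup.m_inv_closed)
    ultimately have l: "l \<in> ?L"
      using MG by (auto simp: kernel_def)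
    then have lG: "l \<in> carrier G" using LG by blast
    have "x = l \<otimes> y"
      using xy by (simp add: l_def m_assoc)
    then have "b x = b l \<otimes> b y"
      using hom_mult[OF b lG xy(2)] by simp
    then have "M #> b x = (M #> b l) #> b y"
      using MG bG lG xy by (simp add: coset_mult_assoc)
    \<comment> \<open>Because of this absorption \<open>M #> b l\<close> depends only on the coset
      \<open>?L #> b l\<close>, and finitely many of these occur.\<close>
    moreover have "M <#> ?L = M"
    proof
      show "M <#> ?L \<subseteq> M"
        using mono_set_mult[of M M ?L M G] subgroup_mult_id[OF M] by auto
      show "M \<subseteq> M <#> ?L"
      proof
        fix z assume "z \<in> M"
        then have "z = z \<otimes> \<one>" using MG by auto
        then show "z \<in> M <#> ?L"
          using \<open>z \<in> M\<close> subgroup.one_closed[OF L] unfolding set_mult_def by blast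
      qed
    qed
    then have "M #> b l = M <#> (?L #> b l)"
      using MG LG bG[OF lG] by (simp add: setmult_rcos_assoc)
    ultimately have "M #> b x = (M <#> (?L #> b l)) #> b (m (k x))"
      by (simp add: y_def)
    with l x show "M #> b x \<in> (\<lambda>(C, c). (M <#> C) #> b (m c)) ` ((\<lambda>x. ?L #> b x) ` ?L \<times> k ` M)"
      by (intro image_eqI[where x = "(?L #> b l, k x)"]) auto
  qed
  then show ?thesis
    by (rule finite_subset) (intro finite_imageI finite_cartesian_product fin k(3))
qed

section \<open>Flags of an abstract polytope\<close>

locale polytope =
  fixes n :: nat and r :: "'a rel"
  assumes abstract_polytope: "abstract_polytope n r"
begin

section \<open>Chains and flags\<close>

lemma refl_r: "x \<in> Field r \<Longrightarrow> (x, x) \<in> r"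
  and antisym_r: "(x, y) \<in> r \<Longrightarrow> (y, x) \<in> r \<Longrightarrow> x = y"
  and trans_r: "(x, y) \<in> r \<Longrightarrow> (y, z) \<in> r \<Longrightarrow> (x, z) \<in> r"
proof -
  have "Partial_order r" using abstract_polytope by (simp add: abstract_polytope_def)
  then have "Refl r" "antisym r" "trans r"
    by (auto simp: partial_order_on_def preorder_on_def)
  then show "x \<in> Field r \<Longrightarrow> (x, x) \<in> r" "(x, y) \<in> r \<Longrightarrow> (y, x) \<in> r \<Longrightarrow> x = y"
    "(x, y) \<in> r \<Longrightarrow> (y, z) \<in> r \<Longrightarrow> (x, z) \<in> r"
    by (auto simp: refl_on_def dest: antisymD transD)
qed

lemma chain_Field: "C \<in> Chains r \<Longrightarrow> C \<subseteq> Field r"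
  by (auto simp: Chains_def intro: FieldI1)

lemma flag_chain: "\<Phi> \<in> flags r \<Longrightarrow> \<Phi> \<in> Chains r"
  by (simp add: flags_def)

lemma flag_Field: "\<Phi> \<in> flags r \<Longrightarrow> x \<in> \<Phi> \<Longrightarrow> x \<in> Field r"
  using chain_Field flag_chain by blast

lemma flag_comparable: "\<Phi> \<in> flags r \<Longrightarrow> x \<in> \<Phi> \<Longrightarrow> y \<in> \<Phi> \<Longrightarrow> (x, y) \<in> r \<or> (y, x) \<in> r"
  using flag_chain by (auto simp: Chains_def)

lemma card_flag: "\<Phi> \<in> flags r \<Longrightarrow> card \<Phi> = n + 2"
  using abstract_polytope by (simp add: abstract_polytope_def)

lemma finite_flag: "\<Phi> \<in> flags r \<Longrightarrow> finite \<Phi>"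
  using card_flag by (intro card_ge_0_finite) simp

text \<open>Zorn's lemma for the chains containing \<open>C\<close>, as there may be infinitely many
  faces.\<close>

lemma chain_extends_to_flag:
  assumes C: "C \<in> Chains r"
  obtains \<Phi> where "\<Phi> \<in> flags r" "C \<subseteq> \<Phi>"
proof -
  let ?A = "{D \<in> Chains r. C \<subseteq> D}"
  have "\<exists>M\<in>?A. \<forall>X\<in>?A. M \<subseteq> X \<longrightarrow> X = M"
  proof (rule subset_Zorn_nonempty)
    show "?A \<noteq> {}" using C by blast
    fix K assume K: "K \<noteq> {}" "subset.chain ?A K"
    then have KA: "K \<subseteq> ?A" and lin: "\<And>X Y. X \<in> K \<Longrightarrow> Y \<in> K \<Longrightarrow> X \<subseteq> Y \<or> Y \<subseteq> X"
      by (simp_all add: subset_chain_def)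
    have "(x, y) \<in> r \<or> (y, x) \<in> r" if xy: "x \<in> X" "X \<in> K" "y \<in> Y" "Y \<in> K" for x y X Y
    proof -
      \<comment> \<open>\<open>Z\<close> is the larger of the two chains \<open>X\<close> and
        \<open>Y\<close>.\<close>
      obtain Z where "Z \<in> K" "x \<in> Z" "y \<in> Z"
        using xy lin[of X Y] by blast
      then show ?thesis using KA by (auto simp: Chains_def)
    qed
    then have "\<Union>K \<in> Chains r"
      unfolding Chains_def by blast
    moreover have "C \<subseteq> \<Union>K" using K(1) KA by blast
    ultimately show "\<Union>K \<in> ?A" by blast
  qed
  then obtain M where M: "M \<in> Chains r" "C \<subseteq> M" "\<forall>X\<in>?A. M \<subseteq> X \<longrightarrow> X = M"
    by blast
  have "M \<in> flags r"
    unfolding flags_def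
  proof (intro CollectI conjI ballI impI)
    fix \<Psi> assume "\<Psi> \<in> Chains r" "M \<subseteq> \<Psi>"
    then show "\<Psi> = M" using M by blast
  qed (rule M(1))
  with M(2) show thesis by (intro that)
qed

lemma chain_card_le:
  assumes "C \<in> Chains r"
  shows "card C \<le> n + 2"
proof -
  obtain \<Phi> where "\<Phi> \<in> flags r" "C \<subseteq> \<Phi>" using chain_extends_to_flag[OF assms] .
  then show ?thesis
    using finite_flag[of \<Phi>] card_flag[of \<Phi>] card_mono by metis
qed

text \<open>A flag containing \<open>C\<close> has the same finite size and hence equals it. Images
  of flags and flags with one face exchanged are recognized as flags this way.\<close>

lemma chain_card_flag:
  assumes "C \<in> Chains r" "card C = n + 2"
  shows "C \<in> flags r"
proof -
  obtain \<Phi> where "\<Phi> \<in> flags r" "C \<subseteq> \<Phi>" using chain_extends_to_flag[OF assms(1)] .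
  then show ?thesis
    using finite_flag[of \<Phi>] card_flag[of \<Phi>] assms(2) card_subset_eq by metis
qed

lemma face_in_flag:
  assumes "F \<in> Field r"
  obtains \<Phi> where "\<Phi> \<in> flags r" "F \<in> \<Phi>"
proof -
  have "{F} \<in> Chains r" using refl_r[OF assms] by (simp add: Chains_def)
  then show thesis using chain_extends_to_flag that by blast
qed

section \<open>Ranks of faces\<close>

lemma flag_card_split:
  assumes "\<Phi> \<in> flags r" "F \<in> \<Phi>"
  shows "card (\<Phi> \<inter> underS r F) + card (\<Phi> - underS r F) = n + 2"
  using card_flag[OF assms(1)] finite_flag[OF assms(1)] by (metis card_Int_Diff)

text \<open>The faces of \<open>\<Phi>\<close> below \<open>F\<close> and those of \<open>\<Psi>\<close> not below \<open>F\<close> form a chain.\<close>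

lemma card_below_le:
  assumes \<Phi>: "\<Phi> \<in> flags r" "F \<in> \<Phi>" and \<Psi>: "\<Psi> \<in> flags r" "F \<in> \<Psi>"
  shows "card (\<Phi> \<inter> underS r F) \<le> card (\<Psi> \<inter> underS r F)"
proof -
  have up: "(F, x) \<in> r" if "x \<in> \<Psi> - underS r F" for x
    using that flag_comparable[OF \<Psi>(1), of F x] \<Psi>(2) refl_r flag_Field[OF \<Psi>]
    by (auto simp: underS_def)
  have "(\<Phi> \<inter> underS r F) \<union> (\<Psi> - underS r F) \<in> Chains r"
    unfolding Chains_def
  proof (intro CollectI ballI)
    fix x y assume *: "x \<in> (\<Phi> \<inter> underS r F) \<union> (\<Psi> - underS r F)"
      "y \<in> (\<Phi> \<inter> underS r F) \<union> (\<Psi> - underS r F)"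
    have below: "(z, F) \<in> r" if "z \<in> underS r F" for z
      using that by (simp add: underS_def)
    show "(x, y) \<in> r \<or> (y, x) \<in> r"
      using * flag_comparable[OF \<Phi>(1), of x y] flag_comparable[OF \<Psi>(1), of x y]
        up[of x] up[of y] below[of x] below[of y] trans_r[of x F y] trans_r[of y F x] by blast
  qed
  from chain_card_le[OF this]
  have "card (\<Phi> \<inter> underS r F) + card (\<Psi> - underS r F) \<le> n + 2"
    using finite_flag[OF \<Phi>(1)] finite_flag[OF \<Psi>(1)]
    by (subst (asm) card_Un_disjoint) auto
  with flag_card_split[OF \<Psi>] show ?thesis by linarith
qed

text \<open>Exchanging the roles of the two flags in \<open>card_below_le\<close> gives equality, so
  the flag chosen by \<open>SOME\<close> can be replaced by any flag through
  \<open>F\<close>.\<close>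

lemma face_rank_eq:
  assumes "\<Phi> \<in> flags r" "F \<in> \<Phi>"
  shows "face_rank r F = int (card (\<Phi> \<inter> underS r F)) - 1"
proof -
  let ?\<Psi> = "SOME \<Phi>. \<Phi> \<in> flags r \<and> F \<in> \<Phi>"
  have "?\<Psi> \<in> flags r \<and> F \<in> ?\<Psi>" 
    using someI[of "\<lambda>\<Phi>. \<Phi> \<in> flags r \<and> F \<in> \<Phi>" \<Phi>] assms by blast
  then have "card (?\<Psi> \<inter> underS r F) = card (\<Phi> \<inter> underS r F)"
    using assms card_below_le by (metis le_antisym)
  then show ?thesis by (simp add: face_rank_def)
qed

text \<open>Both ranks can be counted in one flag through \<open>F\<close> and \<open>G\<close>,
  where the faces below \<open>F\<close> are properly contained in those below
  \<open>G\<close>.\<close>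

lemma face_rank_less:
  assumes "(F, G) \<in> r" "F \<noteq> G"
  shows "face_rank r F < face_rank r G"
proof -
  have "{F, G} \<in> Chains r"
    using assms refl_r[of F] refl_r[of G] by (auto simp: Chains_def intro: FieldI1 FieldI2)
  from chain_extends_to_flag[OF this] obtain \<Phi> where \<Phi>: "\<Phi> \<in> flags r" "{F, G} \<subseteq> \<Phi>" .
  have "\<Phi> \<inter> underS r F \<subseteq> \<Phi> \<inter> underS r G"
    using assms trans_r antisym_r by (auto simp: underS_def)
  moreover have "F \<in> \<Phi> \<inter> underS r G" "F \<notin> \<Phi> \<inter> underS r F"
    using assms \<Phi> by (auto simp: underS_def)
  ultimately have "card (\<Phi> \<inter> underS r F) < card (\<Phi> \<inter> underS r G)"
    using finite_flag[OF \<Phi>(1)] by (intro psubset_card_mono) auto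
  then show ?thesis using \<Phi> by (simp add: face_rank_eq)
qed

section \<open>Flags as sequences of faces indexed by rank\<close>

lemma flag_rank_le_iff:
  assumes "\<Phi> \<in> flags r" "F \<in> \<Phi>" "G \<in> \<Phi>"
  shows "(F, G) \<in> r \<longleftrightarrow> face_rank r F \<le> face_rank r G"
proof (cases "F = G")
  case True
  then show ?thesis using refl_r[OF flag_Field[OF assms(1,2)]] by simp
next
  case False
  then show ?thesis
    using flag_comparable[OF assms] face_rank_less[of F G] face_rank_less[of G F] by fastforce
qed

text \<open>Comparable faces of equal rank coincide, and the \<open>n + 2\<close> faces of a flag
  have to fill the \<open>n + 2\<close> values from -1 to \<open>n\<close>.\<close>

lemma flag_rank_bij:
  assumes \<Phi>: "\<Phi> \<in> flags r"
  shows "bij_betw (face_rank r) \<Phi> {-1..int n}"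
proof -
  have inj: "inj_on (face_rank r) \<Phi>"
  proof (rule inj_onI)
    fix F G assume "F \<in> \<Phi>" "G \<in> \<Phi>" "face_rank r F = face_rank r G"
    then have "(F, G) \<in> r" "(G, F) \<in> r" by (simp_all add: flag_rank_le_iff[OF \<Phi>])
    then show "F = G" by (rule antisym_r)
  qed
  have "face_rank r F \<in> {-1..int n}" if F: "F \<in> \<Phi>" for F
  proof -
    \<comment> \<open>\<open>F\<close> is not strictly below itself, so at most \<open>n + 1\<close>
      faces are, and the rank is at most \<open>n\<close>.\<close>
    have "card (\<Phi> - underS r F) > 0"
      using F finite_flag[OF \<Phi>] by (auto simp: card_gt_0_iff underS_def)
    then show ?thesis using flag_card_split[OF \<Phi> F] by (auto simp: face_rank_eq[OF \<Phi> F])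
  qed
  then have "face_rank r ` \<Phi> \<subseteq> {-1..int n}" by blast
  moreover have "card (face_rank r ` \<Phi>) = card {-1..int n}"
    using card_image[OF inj] card_flag[OF \<Phi>] by simp
  ultimately have "face_rank r ` \<Phi> = {-1..int n}"
    by (intro card_subset_eq) auto
  with inj show ?thesis by (simp add: bij_betw_def)
qed

text \<open>Reads a flag as a sequence, so that adjacency of flags becomes a difference in exactly
  one entry.\<close>

definition face :: "'a set \<Rightarrow> int \<Rightarrow> 'a" where
  "face \<Phi> = inv_into \<Phi> (face_rank r)"

lemma face_mem: "\<Phi> \<in> flags r \<Longrightarrow> k \<in> {-1..int n} \<Longrightarrow> face \<Phi> k \<in> \<Phi>"
  and face_rank_face: "\<Phi> \<in> flags r \<Longrightarrow> k \<in> {-1..int n} \<Longrightarrow> face_rank r (face \<Phi> k) = k"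
  using flag_rank_bij[of \<Phi>] unfolding face_def
  by (auto simp: bij_betw_def intro: inv_into_into f_inv_into_f)

lemma face_eqI: "\<Phi> \<in> flags r \<Longrightarrow> F \<in> \<Phi> \<Longrightarrow> face_rank r F = k \<Longrightarrow> face \<Phi> k = F"
  using flag_rank_bij[of \<Phi>] unfolding face_def by (auto simp: bij_betw_def)

lemma rank_in_flag: "\<Phi> \<in> flags r \<Longrightarrow> F \<in> \<Phi> \<Longrightarrow> face_rank r F \<in> {-1..int n}"
  using flag_rank_bij[of \<Phi>] by (auto simp: bij_betw_def)

lemma flag_eq_faces:
  assumes "\<Phi> \<in> flags r"
  shows "\<Phi> = face \<Phi> ` {-1..int n}"
proof (intro equalityI subsetI)
  fix F assume "F \<in> \<Phi>"
  with assms show "F \<in> face \<Phi> ` {-1..int n}"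
    by (intro image_eqI[OF face_eqI[symmetric] rank_in_flag]) simp_all
qed (use assms face_mem in auto)

lemma flag_eqI:
  assumes "\<Phi> \<in> flags r" "\<Psi> \<in> flags r" "\<And>k. k \<in> {-1..int n} \<Longrightarrow> face \<Phi> k = face \<Psi> k"
  shows "\<Phi> = \<Psi>"
proof -
  have "\<Phi> = face \<Phi> ` {-1..int n}" by (rule flag_eq_faces[OF assms(1)])
  also have "\<dots> = face \<Psi> ` {-1..int n}" using assms(3) by (rule image_cong[OF refl])
  also have "\<dots> = \<Psi>" by (rule flag_eq_faces[OF assms(2), symmetric])
  finally show ?thesis .
qed

lemma face_less:
  assumes "\<Phi> \<in> flags r" "k \<in> {-1..int n}" "l \<in> {-1..int n}" "k < l"
  shows "face \<Phi> k \<in> underS r (face \<Phi> l)"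
proof -
  have "(face \<Phi> k, face \<Phi> l) \<in> r"
    using assms flag_rank_le_iff[of \<Phi>] by (simp add: face_mem face_rank_face)
  moreover have "face \<Phi> k \<noteq> face \<Phi> l"
    using assms face_rank_face[OF assms(1)] by (metis less_irrefl)
  ultimately show ?thesis by (simp add: underS_def)
qed

text \<open>The diamond condition leaves only two faces between \<open>F\<close> and
  \<open>G\<close>, hence only one besides \<open>H0\<close>.\<close>

lemma rank2_section_unique:
  assumes "F \<in> underS r H0" "H0 \<in> underS r G" "F \<in> underS r H1" "H1 \<in> underS r G"
    "F \<in> underS r H2" "H2 \<in> underS r G" "face_rank r G = face_rank r F + 2"
    and "H1 \<noteq> H0" "H2 \<noteq> H0"
  shows "H1 = H2"
proof -
  let ?S = "{H. F \<in> underS r H \<and> H \<in> underS r G}"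
  have "(F, G) \<in> r" using assms(1,2) trans_r by (auto simp: underS_def)
  then have "card ?S = 2"
    using abstract_polytope assms(7) by (simp add: abstract_polytope_def)
  then obtain a b where ab: "?S = {a, b}" by (auto simp: card_2_iff)
  have "H0 \<in> ?S" "H1 \<in> ?S" "H2 \<in> ?S" using assms by auto
  then show ?thesis using assms(8,9) unfolding ab by auto
qed

text \<open>The diamond condition in terms of flags, applied between the faces of ranks
  \<open>i - 1\<close> and \<open>i + 1\<close>. It yields both the uniqueness of adjacent flags and
  the commutation of distant adjacencies.\<close>

lemma flag_face_opposite:
  assumes fl: "\<Phi>0 \<in> flags r" "\<Phi>1 \<in> flags r" "\<Phi>2 \<in> flags r" and i: "i < n"
    and "face \<Phi>1 (int i - 1) = face \<Phi>0 (int i - 1)" "face \<Phi>2 (int i - 1) = face \<Phi>0 (int i - 1)"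
    and "face \<Phi>1 (int i + 1) = face \<Phi>0 (int i + 1)" "face \<Phi>2 (int i + 1) = face \<Phi>0 (int i + 1)"
    and "face \<Phi>1 (int i) \<noteq> face \<Phi>0 (int i)" "face \<Phi>2 (int i) \<noteq> face \<Phi>0 (int i)"
  shows "face \<Phi>1 (int i) = face \<Phi>2 (int i)"
proof -
  have k: "int i - 1 \<in> {-1..int n}" "int i \<in> {-1..int n}" "int i + 1 \<in> {-1..int n}"
    using i by auto
  show ?thesis
  proof (rule rank2_section_unique[of "face \<Phi>0 (int i - 1)" "face \<Phi>0 (int i)" "face \<Phi>0 (int i + 1)"])
    show "face_rank r (face \<Phi>0 (int i + 1)) = face_rank r (face \<Phi>0 (int i - 1)) + 2"
      using k face_rank_face[OF fl(1)] by simp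
  qed (use assms k face_less[OF fl(1), of "int i - 1" "int i"] face_less[OF fl(1), of "int i" "int i + 1"]
      face_less[OF fl(2), of "int i - 1" "int i"] face_less[OF fl(2), of "int i" "int i + 1"]
      face_less[OF fl(3), of "int i - 1" "int i"] face_less[OF fl(3), of "int i" "int i + 1"] in auto)
qed

text \<open>Were the face of rank \<open>n\<close> not the greatest face, the latter would have rank
  above \<open>n\<close>.\<close>

lemma face_top:
  assumes "\<Phi> \<in> flags r" "\<Psi> \<in> flags r"
  shows "face \<Phi> (int n) = face \<Psi> (int n)"
proof -
  obtain T where T: "T \<in> Field r" "\<And>G. G \<in> Field r \<Longrightarrow> (G, T) \<in> r"
    using abstract_polytope by (auto simp: abstract_polytope_def)
  have "face \<Phi> (int n) = T" if \<Phi>: "\<Phi> \<in> flags r" for \<Phi>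
  proof (rule ccontr)
    assume "face \<Phi> (int n) \<noteq> T"
    moreover have "face \<Phi> (int n) \<in> Field r"
      using \<Phi> face_mem[OF \<Phi>] flag_Field[OF \<Phi>] by simp
    ultimately have "int n < face_rank r T"
      using face_rank_less[OF T(2)] face_rank_face[OF \<Phi>, of "int n"] by fastforce
    moreover obtain \<Psi> where "\<Psi> \<in> flags r" "T \<in> \<Psi>" using face_in_flag[OF T(1)] .
    ultimately show False using rank_in_flag by fastforce
  qed
  then show ?thesis using assms by simp
qed

section \<open>Adjacent flags\<close>

text \<open>The set equation in the definition says that the sequences agree outside position
  \<open>i\<close>. The bound \<open>i < n\<close> arises because all flags share the face of rank
  \<open>n\<close> and have no faces of larger rank.\<close>

lemma i_adjacent_iff:
  assumes fl: "\<Phi> \<in> flags r" "\<Psi> \<in> flags r"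
  shows "i_adjacent r i \<Phi> \<Psi> \<longleftrightarrow> i < n \<and> face \<Phi> (int i) \<noteq> face \<Psi> (int i) \<and>
    (\<forall>k\<in>{-1..int n}. k \<noteq> int i \<longrightarrow> face \<Phi> k = face \<Psi> k)"
proof
  assume adj: "i_adjacent r i \<Phi> \<Psi>"
  then have eq: "{F \<in> \<Phi>. face_rank r F \<noteq> int i} = {F \<in> \<Psi>. face_rank r F \<noteq> int i}" and "\<Phi> \<noteq> \<Psi>"
    by (auto simp: i_adjacent_def)
  have same: "face \<Phi> k = face \<Psi> k" if "k \<in> {-1..int n}" "k \<noteq> int i" for k
  proof -
    have "face \<Phi> k \<in> {F \<in> \<Phi>. face_rank r F \<noteq> int i}"
      using fl(1) that by (simp add: face_mem face_rank_face)
    then have "face \<Phi> k \<in> \<Psi>" unfolding eq by simp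
    then show ?thesis using face_eqI[OF fl(2) _ face_rank_face[OF fl(1)]] that by simp
  qed
  moreover have "i < n \<and> face \<Phi> (int i) \<noteq> face \<Psi> (int i)"
  proof (rule ccontr)
    assume neg: "\<not> (i < n \<and> face \<Phi> (int i) \<noteq> face \<Psi> (int i))"
    have "face \<Phi> k = face \<Psi> k" if k: "k \<in> {-1..int n}" for k
    proof (cases "k = int i")
      case True
      with k neg have "k = int n \<or> face \<Phi> (int i) = face \<Psi> (int i)" by auto
      then show ?thesis using face_top[OF fl] True by auto
    qed (rule same[OF k])
    then show False using flag_eqI[OF fl] \<open>\<Phi> \<noteq> \<Psi>\<close> by blast
  qed
  ultimately show "i < n \<and> face \<Phi> (int i) \<noteq> face \<Psi> (int i) \<and>
    (\<forall>k\<in>{-1..int n}. k \<noteq> int i \<longrightarrow> face \<Phi> k = face \<Psi> k)" by blast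
next
  assume R: "i < n \<and> face \<Phi> (int i) \<noteq> face \<Psi> (int i) \<and>
    (\<forall>k\<in>{-1..int n}. k \<noteq> int i \<longrightarrow> face \<Phi> k = face \<Psi> k)"
  have sub: "{F \<in> \<Phi>'. face_rank r F \<noteq> int i} \<subseteq> {F \<in> \<Psi>'. face_rank r F \<noteq> int i}"
    if "\<Phi>' \<in> flags r" "\<Psi>' \<in> flags r"
      "\<forall>k\<in>{-1..int n}. k \<noteq> int i \<longrightarrow> face \<Phi>' k = face \<Psi>' k" for \<Phi>' \<Psi>'
  proof safe
    fix F assume "F \<in> \<Phi>'" "face_rank r F \<noteq> int i"
    moreover have rF: "face_rank r F \<in> {-1..int n}"
      using that(1) \<open>F \<in> \<Phi>'\<close> by (rule rank_in_flag)
    moreover have "face \<Phi>' (face_rank r F) = F"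
      using that(1) \<open>F \<in> \<Phi>'\<close> by (rule face_eqI) simp
    ultimately have "face \<Psi>' (face_rank r F) = F"
      using that(3) by simp
    then show "F \<in> \<Psi>'"
      using face_mem[OF that(2) rF] by simp
  qed
  have "{F \<in> \<Phi>. face_rank r F \<noteq> int i} = {F \<in> \<Psi>. face_rank r F \<noteq> int i}"
    using R by (intro subset_antisym sub fl) auto
  moreover have "\<Phi> \<noteq> \<Psi>" using R by blast
  ultimately show "i_adjacent r i \<Phi> \<Psi>"
    unfolding i_adjacent_def using fl by blast
qed

lemma i_adjacentD:
  assumes "i_adjacent r i \<Phi> \<Psi>"
  shows "\<Phi> \<in> flags r" "\<Psi> \<in> flags r" "i < n" "face \<Psi> (int i) \<noteq> face \<Phi> (int i)"
    "k \<in> {-1..int n} \<Longrightarrow> k \<noteq> int i \<Longrightarrow> face \<Psi> k = face \<Phi> k"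
proof -
  show fl: "\<Phi> \<in> flags r" "\<Psi> \<in> flags r"
    using assms by (simp_all add: i_adjacent_def)
  note R = assms[unfolded i_adjacent_iff[OF fl]]
  from R show "i < n" by (rule conjunct1)
  from R show "face \<Psi> (int i) \<noteq> face \<Phi> (int i)" by metis
  from R show "k \<in> {-1..int n} \<Longrightarrow> k \<noteq> int i \<Longrightarrow> face \<Psi> k = face \<Phi> k" by metis
qed

lemma i_adjacent_unique:
  assumes "i_adjacent r i \<Phi> \<Psi>" "i_adjacent r i \<Phi> \<Psi>'"
  shows "\<Psi> = \<Psi>'"
proof -
  note a = i_adjacentD[OF assms(1)] and b = i_adjacentD[OF assms(2)]
  have "face \<Psi> (int i) = face \<Psi>' (int i)"
    by (rule flag_face_opposite[OF a(1,2) b(2) a(3)]) (use a(3) a(4) b(4) in \<open>simp_all add: a(5) b(5)\<close>)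
  show ?thesis
  proof (rule flag_eqI[OF a(2) b(2)])
    fix k assume "k \<in> {-1..int n}"
    then have "face \<Psi> k = face \<Psi>' k" if "k \<noteq> int i"
      using that \<open>k \<in> {-1..int n}\<close> by (simp add: a(5) b(5))
    with \<open>face \<Psi> (int i) = face \<Psi>' (int i)\<close> show "face \<Psi> k = face \<Psi>' k" by blast
  qed
qed

text \<open>The diamond condition supplies a second face \<open>H1\<close> between the neighbours of
  \<open>H0\<close>; exchanging \<open>H0\<close> for \<open>H1\<close> gives a chain of
  \<open>n + 2\<close> faces.\<close>

lemma i_adjacent_ex:
  assumes \<Phi>: "\<Phi> \<in> flags r" and i: "i < n"
  shows "\<exists>\<Psi>. i_adjacent r i \<Phi> \<Psi>"
proof -
  define F where "F = face \<Phi> (int i - 1)"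
  define G where "G = face \<Phi> (int i + 1)"
  define H0 where "H0 = face \<Phi> (int i)"
  let ?S = "{H. F \<in> underS r H \<and> H \<in> underS r G}"
  have k: "int i - 1 \<in> {-1..int n}" "int i \<in> {-1..int n}" "int i + 1 \<in> {-1..int n}"
    using i by auto
  have mem: "F \<in> \<Phi>" "G \<in> \<Phi>" "H0 \<in> \<Phi>"
    using k face_mem[OF \<Phi>] by (auto simp: F_def G_def H0_def)
  have rk: "face_rank r F = int i - 1" "face_rank r G = int i + 1" "face_rank r H0 = int i"
    using k face_rank_face[OF \<Phi>] by (auto simp: F_def G_def H0_def)
  have "(F, G) \<in> r" using mem rk flag_rank_le_iff[OF \<Phi>] by simp
  then have "card ?S = 2"
    using abstract_polytope rk by (simp add: abstract_polytope_def)
  then obtain a b where ab: "?S = {a, b}" "a \<noteq> b" by (auto simp: card_2_iff)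
  then obtain H1 where H1: "H1 \<in> ?S" "H1 \<noteq> H0" by blast
  then have H1r: "(F, H1) \<in> r" "(H1, G) \<in> r" "F \<noteq> H1" "H1 \<noteq> G"
    by (auto simp: underS_def)
  then have rH1: "face_rank r H1 = int i"
    using face_rank_less[of F H1] face_rank_less[of H1 G] rk by auto
  have "H1 \<notin> \<Phi>"
    using face_eqI[OF \<Phi> _ rH1] face_eqI[OF \<Phi> mem(3) rk(3)] H1(2) by auto
  define \<Psi> where "\<Psi> = insert H1 (\<Phi> - {H0})"
  \<comment> \<open>Every remaining face of the flag lies below \<open>F\<close> or above
    \<open>G\<close>, hence is comparable with \<open>H1\<close>.\<close>
  have cmp: "(x, H1) \<in> r \<or> (H1, x) \<in> r" if x: "x \<in> \<Phi> - {H0}" for x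
  proof -
    have "face_rank r x \<noteq> int i"
      using x face_eqI[OF \<Phi>, of x] face_eqI[OF \<Phi> mem(3) rk(3)] by auto
    then have "face_rank r x \<le> int i - 1 \<or> face_rank r x \<ge> int i + 1" by linarith
    then have "(x, F) \<in> r \<or> (G, x) \<in> r"
      using x mem rk flag_rank_le_iff[OF \<Phi>] by auto
    then show ?thesis using H1r trans_r by blast
  qed
  have "(H1, H1) \<in> r" using H1r(1) by (intro refl_r FieldI2)
  then have "\<Psi> \<in> Chains r"
    unfolding Chains_def \<Psi>_def using cmp flag_comparable[OF \<Phi>] by auto
  moreover have "card \<Psi> = n + 2"
    using \<open>H1 \<notin> \<Phi>\<close> finite_flag[OF \<Phi>] card_flag[OF \<Phi>] mem(3) by (simp add: \<Psi>_def)
  ultimately have "\<Psi> \<in> flags r" by (rule chain_card_flag)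
  moreover have "\<Phi> \<noteq> \<Psi>" using \<open>H1 \<notin> \<Phi>\<close> by (auto simp: \<Psi>_def)
  moreover have "{F \<in> \<Phi>. face_rank r F \<noteq> int i} = {F \<in> \<Psi>. face_rank r F \<noteq> int i}"
    using rk rH1 by (auto simp: \<Psi>_def)
  ultimately show ?thesis using \<Phi> unfolding i_adjacent_def by blast
qed

lemma adj_flag_adjacent:
  assumes "\<Phi> \<in> flags r" "i < n"
  shows "i_adjacent r i \<Phi> (adj_flag r i \<Phi>)"
proof -
  have "\<exists>!\<Psi>. i_adjacent r i \<Phi> \<Psi>"
    using i_adjacent_ex[OF assms] i_adjacent_unique by blast
  then show ?thesis unfolding adj_flag_def by (rule theI')
qed

lemma adj_flag_eqI:
  assumes "i_adjacent r i \<Phi> \<Psi>"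
  shows "adj_flag r i \<Phi> = \<Psi>"
  unfolding adj_flag_def using assms by (rule the_equality) (rule i_adjacent_unique[OF _ assms])

lemma adj_flag_flag: "\<Phi> \<in> flags r \<Longrightarrow> i < n \<Longrightarrow> adj_flag r i \<Phi> \<in> flags r"
  using adj_flag_adjacent[of \<Phi> i] by (simp add: i_adjacent_def)

lemma adj_flag_adj_flag: "\<Phi> \<in> flags r \<Longrightarrow> i < n \<Longrightarrow> adj_flag r i (adj_flag r i \<Phi>) = \<Phi>"
  using adj_flag_adjacent[of \<Phi> i] by (intro adj_flag_eqI) (auto simp: i_adjacent_def)

lemma face_adj_flag:
  assumes "\<Phi> \<in> flags r" "i < n"
  shows "face (adj_flag r i \<Phi>) (int i) \<noteq> face \<Phi> (int i)"
    and "k \<in> {-1..int n} \<Longrightarrow> k \<noteq> int i \<Longrightarrow> face (adj_flag r i \<Phi>) k = face \<Phi> k"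
  using i_adjacentD(4,5)[OF adj_flag_adjacent[OF assms]] by blast+

text \<open>A change at one rank leaves the neighbouring faces of the other rank alone. Both
  composites therefore differ from the flag at ranks \<open>i\<close> and \<open>j\<close> only, and
  there the diamond condition determines them.\<close>

lemma adj_flag_commute:
  assumes \<Phi>: "\<Phi> \<in> flags r" and ij: "i < n" "j < n" "i + 2 \<le> j \<or> j + 2 \<le> i"
  shows "adj_flag r i (adj_flag r j \<Phi>) = adj_flag r j (adj_flag r i \<Phi>)"
proof -
  have fl: "adj_flag r i (adj_flag r j \<Phi>) \<in> flags r" "adj_flag r i \<Phi> \<in> flags r"
      "adj_flag r j (adj_flag r i \<Phi>) \<in> flags r" "adj_flag r j \<Phi> \<in> flags r"
    using \<Phi> ij by (auto intro: adj_flag_flag)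
  have k: "int i - 1 \<in> {-1..int n}" "int i \<in> {-1..int n}" "int i + 1 \<in> {-1..int n}"
    "int j - 1 \<in> {-1..int n}" "int j \<in> {-1..int n}" "int j + 1 \<in> {-1..int n}"
    using ij by auto
  note f = face_adj_flag[OF \<Phi> ij(1)] face_adj_flag[OF \<Phi> ij(2)]
    face_adj_flag[OF fl(4) ij(1)] face_adj_flag[OF fl(2) ij(2)]
  have d: "int i \<noteq> int j" "int i - 1 \<noteq> int j" "int i + 1 \<noteq> int j" "int j - 1 \<noteq> int i" "int j + 1 \<noteq> int i"
    using ij by auto
  show ?thesis
  proof (rule flag_eqI[OF fl(1,3)])
    fix l assume l: "l \<in> {-1..int n}"
    have "face (adj_flag r i (adj_flag r j \<Phi>)) (int i) = face (adj_flag r j (adj_flag r i \<Phi>)) (int i)"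
      by (rule flag_face_opposite[OF \<Phi> fl(1,3) ij(1)]) (use f k d in auto)
    moreover have "face (adj_flag r i (adj_flag r j \<Phi>)) (int j) = face (adj_flag r j (adj_flag r i \<Phi>)) (int j)"
      by (rule flag_face_opposite[OF \<Phi> fl(1,3) ij(2)]) (use f k d in auto)
    moreover have "face (adj_flag r i (adj_flag r j \<Phi>)) l = face (adj_flag r j (adj_flag r i \<Phi>)) l"
      if "l \<noteq> int i" "l \<noteq> int j"
      using f l that by simp
    ultimately show "face (adj_flag r i (adj_flag r j \<Phi>)) l = face (adj_flag r j (adj_flag r i \<Phi>)) l"
      by blast
  qed
qed

end

section \<open>Automorphisms and rotations\<close>

lemma mem_aut_group_iff:
  "f \<in> carrier (aut_group r) \<longleftrightarrow>
    f \<in> Bij (Field r) \<and> (\<forall>x \<in> Field r. \<forall>y \<in> Field r. (f x, f y) \<in> r \<longleftrightarrow> (x, y) \<in> r)"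
  by (simp add: aut_group_def)

lemma aut_bij: "f \<in> carrier (aut_group r) \<Longrightarrow> bij_betw f (Field r) (Field r)"
  by (simp add: mem_aut_group_iff Bij_def)

lemma aut_Field: "f \<in> carrier (aut_group r) \<Longrightarrow> x \<in> Field r \<Longrightarrow> f x \<in> Field r"
  by (rule bij_betwE[OF aut_bij, THEN bspec])

lemma aut_order:
  "f \<in> carrier (aut_group r) \<Longrightarrow> x \<in> Field r \<Longrightarrow> y \<in> Field r \<Longrightarrow> (f x, f y) \<in> r \<longleftrightarrow> (x, y) \<in> r"
  by (simp add: mem_aut_group_iff)

lemma aut_mult:
  assumes "f \<in> carrier (aut_group r)" "g \<in> carrier (aut_group r)"
  shows "f \<otimes>\<^bsub>aut_group r\<^esub> g = compose (Field r) f g"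
  using assms by (simp add: aut_group_def BijGroup_def)

lemma aut_one: "\<one>\<^bsub>aut_group r\<^esub> = (\<lambda>x\<in>Field r. x)"
  by (simp add: aut_group_def BijGroup_def)

lemma group_aut_group: "group (aut_group r)"
proof -
  interpret B: group "BijGroup (Field r)" by (rule group_BijGroup)
  have "subgroup {f \<in> Bij (Field r). \<forall>x \<in> Field r. \<forall>y \<in> Field r. (f x, f y) \<in> r \<longleftrightarrow> (x, y) \<in> r}
      (BijGroup (Field r))" (is "subgroup ?A _")
  proof (rule B.subgroupI)
    show "?A \<subseteq> carrier (BijGroup (Field r))"
      by (auto simp: BijGroup_def)
    have "(\<lambda>x\<in>Field r. x) \<in> ?A"
      by (simp add: id_Bij)
    then show "?A \<noteq> {}" by blast
  next
    fix f assume f: "f \<in> ?A"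
    then have bij: "bij_betw f (Field r) (Field r)" by (simp add: Bij_def)
    let ?g = "\<lambda>x\<in>Field r. inv_into (Field r) f x"
    have "(?g x, ?g y) \<in> r \<longleftrightarrow> (x, y) \<in> r" if xy: "x \<in> Field r" "y \<in> Field r" for x y
    proof -
      have "?g x \<in> Field r" "?g y \<in> Field r" "f (?g x) = x" "f (?g y) = y"
        using xy bij f by (simp_all add: Bij_inv_into_mem bij_betw_inv_into_right)
      moreover have "(f (?g x), f (?g y)) \<in> r \<longleftrightarrow> (?g x, ?g y) \<in> r"
        using f calculation(1,2) by blast
      ultimately show ?thesis by simp
    qed
    then have "?g \<in> ?A" using f by (simp add: restrict_inv_into_Bij)
    then show "inv\<^bsub>BijGroup (Field r)\<^esub> f \<in> ?A"
      using f by (simp add: inv_BijGroup)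
  next
    fix f g assume fg: "f \<in> ?A" "g \<in> ?A"
    then have "g x \<in> Field r" if "x \<in> Field r" for x
      using Bij_imp_funcset[of g] that by auto
    with fg have "compose (Field r) f g \<in> ?A"
      by (simp add: compose_Bij compose_eq)
    then show "f \<otimes>\<^bsub>BijGroup (Field r)\<^esub> g \<in> ?A"
      using fg by (simp add: BijGroup_def)
  qed
  then show ?thesis
    unfolding aut_group_def by (rule B.subgroup_imp_group)
qed

text \<open>Automorphisms are extensional, and a finite set has finitely many extensional
  self-maps.\<close>

lemma finite_aut_group:
  assumes "finite (Field r)"
  shows "finite (carrier (aut_group r))"
proof (rule finite_subset)
  show "carrier (aut_group r) \<subseteq> Field r \<rightarrow>\<^sub>E Field r"
  proof
    fix f assume f: "f \<in> carrier (aut_group r)"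
    then have "f \<in> extensional (Field r)" by (simp add: mem_aut_group_iff Bij_def)
    with f show "f \<in> Field r \<rightarrow>\<^sub>E Field r" by (auto simp: PiE_def aut_Field)
  qed
  show "finite (Field r \<rightarrow>\<^sub>E Field r)"
    using assms by (simp add: finite_PiE)
qed

context polytope
begin

section \<open>The free action of automorphisms on flags\<close>

lemma aut_inj_on_flag:
  "f \<in> carrier (aut_group r) \<Longrightarrow> \<Phi> \<in> flags r \<Longrightarrow> inj_on f \<Phi>"
  using aut_bij flag_Field by (meson bij_betw_def inj_on_subset subsetI)

lemma aut_flag:
  assumes f: "f \<in> carrier (aut_group r)" and \<Phi>: "\<Phi> \<in> flags r"
  shows "f ` \<Phi> \<in> flags r"
proof (rule chain_card_flag)
  show "f ` \<Phi> \<in> Chains r"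
    using flag_comparable[OF \<Phi>] aut_order[OF f] flag_Field[OF \<Phi>] by (auto simp: Chains_def)
  show "card (f ` \<Phi>) = n + 2"
    using card_image[OF aut_inj_on_flag[OF f \<Phi>]] card_flag[OF \<Phi>] by simp
qed

lemma face_rank_aut:
  assumes f: "f \<in> carrier (aut_group r)" and \<Phi>: "\<Phi> \<in> flags r" "F \<in> \<Phi>"
  shows "face_rank r (f F) = face_rank r F"
proof -
  have "f ` \<Phi> \<inter> underS r (f F) = f ` (\<Phi> \<inter> underS r F)"
    using aut_order[OF f] flag_Field[OF \<Phi>(1)] \<Phi>(2) inj_onD[OF aut_inj_on_flag[OF f \<Phi>(1)]]
    by (auto simp: underS_def)
  moreover have "inj_on f (\<Phi> \<inter> underS r F)"
    using aut_inj_on_flag[OF f \<Phi>(1)] by (rule inj_on_subset) blast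
  ultimately have "card (f ` \<Phi> \<inter> underS r (f F)) = card (\<Phi> \<inter> underS r F)"
    by (simp add: card_image)
  then show ?thesis
    using face_rank_eq[OF aut_flag[OF f \<Phi>(1)]] \<Phi> face_rank_eq[OF \<Phi>] by simp
qed

lemma face_aut:
  assumes f: "f \<in> carrier (aut_group r)" and \<Phi>: "\<Phi> \<in> flags r" and k: "k \<in> {-1..int n}"
  shows "face (f ` \<Phi>) k = f (face \<Phi> k)"
  using face_mem[OF \<Phi> k] face_rank_face[OF \<Phi> k] face_rank_aut[OF f \<Phi>]
  by (intro face_eqI aut_flag f \<Phi>) auto

lemma i_adjacent_aut:
  assumes f: "f \<in> carrier (aut_group r)" and adj: "i_adjacent r i \<Phi> \<Psi>"
  shows "i_adjacent r i (f ` \<Phi>) (f ` \<Psi>)"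
proof -
  note a = i_adjacentD[OF adj]
  have k: "int i \<in> {-1..int n}" using a(3) by auto
  have "face \<Psi> (int i) \<in> Field r" "face \<Phi> (int i) \<in> Field r"
    using flag_Field face_mem k a(1,2) by blast+
  with a(4) have "f (face \<Psi> (int i)) \<noteq> f (face \<Phi> (int i))"
    using aut_bij[OF f] by (auto simp: bij_betw_def dest: inj_onD)
  then show ?thesis
    using k a by (simp add: i_adjacent_iff aut_flag[OF f] face_aut[OF f] del: image_eqI)
qed

lemma adj_flag_aut:
  assumes "f \<in> carrier (aut_group r)" "\<Phi> \<in> flags r" "i < n"
  shows "f ` adj_flag r i \<Phi> = adj_flag r i (f ` \<Phi>)"
  by (rule adj_flag_eqI[OF i_adjacent_aut[OF assms(1) adj_flag_adjacent[OF assms(2,3)]], symmetric])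

text \<open>Automorphisms preserve ranks, so \<open>f x\<close> and \<open>g x\<close> are both the
  face of rank \<open>face_rank r x\<close> in the common image flag.\<close>

lemma aut_eq_on_flag:
  assumes f: "f \<in> carrier (aut_group r)" and g: "g \<in> carrier (aut_group r)"
    and \<Phi>: "\<Phi> \<in> flags r" "f ` \<Phi> = g ` \<Phi>" and x: "x \<in> \<Phi>"
  shows "f x = g x"
proof -
  have k: "face_rank r x \<in> {-1..int n}" using rank_in_flag[OF \<Phi>(1) x] .
  have "face \<Phi> (face_rank r x) = x" using face_eqI[OF \<Phi>(1) x] by simp
  then show ?thesis
    using face_aut[OF f \<Phi>(1) k] face_aut[OF g \<Phi>(1) k] \<Phi>(2) by simp
qed

text \<open>Agreement on a flag passes to each adjacent flag, as adjacent flags are unique, and by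
  connectedness to all flags; every face lies in one of them.\<close>

lemma aut_eqI:
  assumes f: "f \<in> carrier (aut_group r)" and g: "g \<in> carrier (aut_group r)"
    and \<Phi>: "\<Phi> \<in> flags r" "f ` \<Phi> = g ` \<Phi>"
  shows "f = g"
proof -
  have flags: "f ` \<Psi> = g ` \<Psi>" if \<Psi>: "\<Psi> \<in> flags r" for \<Psi>
  proof -
    have "(\<Phi>, \<Psi>) \<in> {(X, Y). adjacent r X Y \<and> \<Phi> \<inter> \<Psi> \<subseteq> X \<and> \<Phi> \<inter> \<Psi> \<subseteq> Y}\<^sup>*"
      using abstract_polytope \<Phi>(1) \<Psi>
      by (simp add: abstract_polytope_def strongly_flag_connected_def)
    then show ?thesis
    proof induction
      case (step X Y)
      then obtain i where "i_adjacent r i X Y" by (auto simp: adjacent_def)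
      from i_adjacent_aut[OF f this] i_adjacent_aut[OF g this, folded step.IH]
      show ?case by (rule i_adjacent_unique)
    qed (rule \<Phi>(2))
  qed
  show ?thesis
  proof (rule extensionalityI[of _ "Field r"])
    fix x assume "x \<in> Field r"
    then obtain \<Psi> where "\<Psi> \<in> flags r" "x \<in> \<Psi>" by (rule face_in_flag)
    then show "f x = g x" by (intro aut_eq_on_flag[OF f g _ flags])
  qed (use f g in \<open>simp_all add: mem_aut_group_iff Bij_def\<close>)
qed

lemma aut_mult_flag:
  assumes "f \<in> carrier (aut_group r)" "g \<in> carrier (aut_group r)" "\<Phi> \<in> flags r"
  shows "(f \<otimes>\<^bsub>aut_group r\<^esub> g) ` \<Phi> = f ` g ` \<Phi>"
  using assms flag_Field[OF assms(3)] by (auto simp: aut_mult compose_eq image_image intro!: image_cong)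

lemma aut_one_flag: "\<Phi> \<in> flags r \<Longrightarrow> \<one>\<^bsub>aut_group r\<^esub> ` \<Phi> = \<Phi>"
  using flag_Field[of \<Phi>] by (force simp: aut_one)

text \<open>Freeness of the action on flags makes the \<open>THE\<close> in
  \<open>aut_moving\<close> well defined.\<close>

lemma aut_moving:
  assumes f: "f \<in> carrier (aut_group r)" and \<Phi>: "\<Phi> \<in> flags r"
  shows "aut_moving r \<Phi> (f ` \<Phi>) = f"
  unfolding aut_moving_def
proof (rule the_equality)
  fix g assume "g \<in> carrier (aut_group r) \<and> g ` \<Phi> = f ` \<Phi>"
  then show "g = f" by (intro aut_eqI[OF _ f \<Phi>]) simp_all
qed (simp add: f)

lemma mem_orbit_self:
  assumes "\<Phi> \<in> flags r"
  shows "\<Phi> \<in> orbit (aut_group r) flag_action \<Phi>"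
proof -
  interpret A: group "aut_group r" by (rule group_aut_group)
  show ?thesis
    using aut_one_flag[OF assms] A.one_closed unfolding orbit_def by (metis (mono_tags, lifting) mem_Collect_eq)
qed

section \<open>Standard rotations and their relations\<close>

text \<open>With a single orbit each \<open>rho\<close> exists, and automorphisms commute with
  passing to adjacent flags, which gives the image under the product. With two orbits each adjacency
  step changes the orbit, so two steps lead back to the orbit of the base flag.\<close>

lemma sigma_flag:
  assumes rot: "chiral_polytope n r \<or> regular_polytope n r" and \<Phi>: "\<Phi> \<in> flags r"
    and i: "1 \<le> i" "i < n"
  shows "sigma n r \<Phi> i \<in> carrier (aut_group r)"
    and "sigma n r \<Phi> i ` \<Phi> = adj_flag r i (adj_flag r (i - 1) \<Phi>)"
proof -
  interpret A: group "aut_group r" by (rule group_aut_group)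
  let ?orb = "orbit (aut_group r) flag_action"
  let ?\<Psi> = "adj_flag r i (adj_flag r (i - 1) \<Phi>)"
  have i': "i - 1 < n" using i by simp
  have fl: "adj_flag r (i - 1) \<Phi> \<in> flags r" "?\<Psi> \<in> flags r" "adj_flag r i \<Phi> \<in> flags r"
    using \<Phi> i i' by (auto intro: adj_flag_flag)
  have "sigma n r \<Phi> i \<in> carrier (aut_group r) \<and> sigma n r \<Phi> i ` \<Phi> = ?\<Psi>"
  proof (cases "regular_polytope n r")
    case True
    then obtain Z where Z: "orbits (aut_group r) (flags r) flag_action = {Z}"
      unfolding regular_polytope_def by (auto simp: card_1_singleton_iff)
    have orb: "?orb X = Z" if "X \<in> flags r" for X
      using Z that unfolding orbits_def by blast
    have rho: "rho r \<Phi> j \<in> carrier (aut_group r) \<and> rho r \<Phi> j ` \<Phi> = adj_flag r j \<Phi>" if "j < n" for j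
    proof -
      have X: "adj_flag r j \<Phi> \<in> flags r" using that \<Phi> by (rule adj_flag_flag[rotated])
      have "adj_flag r j \<Phi> \<in> ?orb \<Phi>"
        using mem_orbit_self[OF X] orb[OF X] orb[OF \<Phi>] by simp
      then obtain f where "f \<in> carrier (aut_group r)" "adj_flag r j \<Phi> = f ` \<Phi>"
        by (auto simp: orbit_def)
      then show ?thesis unfolding rho_def using aut_moving[OF _ \<Phi>] by simp
    qed
    have "(rho r \<Phi> (i - 1) \<otimes>\<^bsub>aut_group r\<^esub> rho r \<Phi> i) ` \<Phi> = ?\<Psi>"
      using rho[OF i'] rho[OF i(2)] \<Phi> i by (simp add: aut_mult_flag adj_flag_aut)
    then show ?thesis
      using True rho[OF i'] rho[OF i(2)] by (simp add: sigma_def)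
  next
    case False
    with rot have ch: "chiral_polytope n r" by simp
    then have "card (orbits (aut_group r) (flags r) flag_action) = 2"
      by (simp add: chiral_polytope_def)
    then obtain A B where AB: "orbits (aut_group r) (flags r) flag_action = {A, B}"
      by (auto simp: card_2_iff)
    have orb: "?orb X \<in> {A, B}" if "X \<in> flags r" for X
      unfolding AB[symmetric] orbits_def using that by blast
    have "?orb \<Phi> \<noteq> ?orb (adj_flag r (i - 1) \<Phi>)" "?orb (adj_flag r (i - 1) \<Phi>) \<noteq> ?orb ?\<Psi>"
      using ch adj_flag_adjacent[OF \<Phi> i'] adj_flag_adjacent[OF fl(1) i(2)]
      unfolding chiral_polytope_def adjacent_def by blast+
    then have "?orb ?\<Psi> = ?orb \<Phi>"
      using orb[OF \<Phi>] orb[OF fl(1)] orb[OF fl(2)] by (elim insertE emptyE) simp_all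
    then have "?\<Psi> \<in> ?orb \<Phi>" using mem_orbit_self[OF fl(2)] by simp
    then obtain f where "f \<in> carrier (aut_group r)" "?\<Psi> = f ` \<Phi>"
      by (auto simp: orbit_def)
    then show ?thesis using False aut_moving[OF _ \<Phi>] by (simp add: sigma_def)
  qed
  then show "sigma n r \<Phi> i \<in> carrier (aut_group r)" "sigma n r \<Phi> i ` \<Phi> = ?\<Psi>" by simp_all
qed

text \<open>Downward induction on \<open>i\<close>: applying \<open>sigma n r \<Phi> i\<close> to
  the image under the shorter run produces two successive changes at rank \<open>i\<close>, which
  cancel.\<close>

lemma sigma_run_flag:
  assumes rot: "chiral_polytope n r \<or> regular_polytope n r" and \<Phi>: "\<Phi> \<in> flags r"
    and ij: "1 \<le> i" "i \<le> j" "j < n"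
  shows "word_eval (aut_group r) (sigma n r \<Phi>) (run_word i j) ` \<Phi> = adj_flag r j (adj_flag r (i - 1) \<Phi>)"
  using ij(2,1)
proof (induction i rule: inc_induct)
  case base
  interpret A: group "aut_group r" by (rule group_aut_group)
  show ?case
    using sigma_flag[OF rot \<Phi> base ij(3)] by simp
next
  case (step i)
  interpret A: group "aut_group r" by (rule group_aut_group)
  have sig: "sigma n r \<Phi> \<in> {1..<n} \<rightarrow> carrier (aut_group r)"
    using sigma_flag(1)[OF rot \<Phi>] by auto
  have i: "i < n" "i - 1 < n" using step ij(3) by auto
  note s = sigma_flag[OF rot \<Phi> step.prems i(1)]
  have "run_word (Suc i) j \<in> words {1..<n}"
    using ij(3) by (intro run_word_words) auto
  then have w: "word_eval (aut_group r) (sigma n r \<Phi>) (run_word (Suc i) j) \<in> carrier (aut_group r)"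
    by (rule A.word_eval_closed[OF sig])
  have "run_word i j = (i, True) # run_word (Suc i) j"
    using step.hyps by (simp add: upt_rec)
  then have "word_eval (aut_group r) (sigma n r \<Phi>) (run_word i j) ` \<Phi> =
      sigma n r \<Phi> i ` word_eval (aut_group r) (sigma n r \<Phi>) (run_word (Suc i) j) ` \<Phi>"
    using s(1) w \<Phi> by (simp add: aut_mult_flag del: upt_Suc)
  \<comment> \<open>The induction hypothesis is the case \<open>Suc i\<close>, whose inner change is
    at rank \<open>Suc i - 1 = i\<close>.\<close>
  also have "\<dots> = sigma n r \<Phi> i ` adj_flag r j (adj_flag r i \<Phi>)"
    using step.IH by simp
  also have "\<dots> = adj_flag r j (adj_flag r i (adj_flag r i (adj_flag r (i - 1) \<Phi>)))"
    using s \<Phi> i ij(3) by (simp add: adj_flag_aut adj_flag_flag)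
  also have "\<dots> = adj_flag r j (adj_flag r (i - 1) \<Phi>)"
    using \<Phi> i by (simp add: adj_flag_adj_flag adj_flag_flag)
  finally show ?case .
qed

text \<open>The ranks \<open>i - 1\<close> and \<open>j\<close> differ by at least two, so the
  corresponding changes commute and doing both twice restores the base flag. An automorphism fixing
  a flag is the identity.\<close>

lemma sigma_run_involution:
  assumes rot: "chiral_polytope n r \<or> regular_polytope n r" and \<Phi>: "\<Phi> \<in> flags r"
    and ij: "1 \<le> i" "i < j" "j < n"
  shows "word_eval (aut_group r) (sigma n r \<Phi>) (run_word i j) \<otimes>\<^bsub>aut_group r\<^esub>
    word_eval (aut_group r) (sigma n r \<Phi>) (run_word i j) = \<one>\<^bsub>aut_group r\<^esub>"
proof -
  interpret A: group "aut_group r" by (rule group_aut_group)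
  define g where "g = word_eval (aut_group r) (sigma n r \<Phi>) (run_word i j)"
  have sig: "sigma n r \<Phi> \<in> {1..<n} \<rightarrow> carrier (aut_group r)"
    using sigma_flag(1)[OF rot \<Phi>] by auto
  have g: "g \<in> carrier (aut_group r)"
    unfolding g_def using ij by (intro A.word_eval_closed[OF sig] run_word_words)
  have g\<Phi>: "g ` \<Phi> = adj_flag r j (adj_flag r (i - 1) \<Phi>)"
    unfolding g_def using sigma_run_flag[OF rot \<Phi>] ij by simp
  have i: "i - 1 < n" "i - 1 + 2 \<le> j" using ij by auto
  have fl: "adj_flag r j \<Phi> \<in> flags r" "adj_flag r (i - 1) \<Phi> \<in> flags r"
    using \<Phi> i ij by (auto intro: adj_flag_flag)
  have "(g \<otimes>\<^bsub>aut_group r\<^esub> g) ` \<Phi> = adj_flag r j (adj_flag r (i - 1) (g ` \<Phi>))"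
    using g \<Phi> fl i(1) ij(3) by (simp add: aut_mult_flag adj_flag_aut g\<Phi>)
  also have "g ` \<Phi> = adj_flag r (i - 1) (adj_flag r j \<Phi>)"
    unfolding g\<Phi> using adj_flag_commute[OF \<Phi> ij(3) i(1)] i(2) by simp
  also have "adj_flag r j (adj_flag r (i - 1) (adj_flag r (i - 1) (adj_flag r j \<Phi>))) = \<Phi>"
    using \<Phi> fl i(1) ij(3) by (simp add: adj_flag_adj_flag)
  finally have "(g \<otimes>\<^bsub>aut_group r\<^esub> g) ` \<Phi> = \<one>\<^bsub>aut_group r\<^esub> ` \<Phi>"
    using aut_one_flag[OF \<Phi>] by simp
  then show ?thesis
    unfolding g_def[symmetric] using g \<Phi> by (intro aut_eqI) auto
qed

text \<open>The relations hold in the full automorphism group and are carried back along the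
  inclusion, a homomorphism under which words keep their value.\<close>

lemma rotation_group_relations:
  assumes rot: "chiral_polytope n r \<or> regular_polytope n r" and \<Phi>: "\<Phi> \<in> flags r"
  shows "sigma n r \<Phi> \<in> {1..<n} \<rightarrow> carrier (rotation_group n r \<Phi>)"
    and "w \<in> Wplus_relators n \<Longrightarrow>
      word_eval (rotation_group n r \<Phi>) (sigma n r \<Phi>) w = \<one>\<^bsub>rotation_group n r \<Phi>\<^esub>"
proof -
  interpret A: group "aut_group r" by (rule group_aut_group)
  show sig: "sigma n r \<Phi> \<in> {1..<n} \<rightarrow> carrier (rotation_group n r \<Phi>)"
    using sigma_flag(1)[OF rot \<Phi>]
    by (auto simp: rotation_group_def carrier_subgroup_generated intro!: generate.incl)
  assume w: "w \<in> Wplus_relators n"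
  have R: "group (rotation_group n r \<Phi>)"
    by (simp add: rotation_group_def)
  have hom: "(\<lambda>x. x) \<in> hom (rotation_group n r \<Phi>) (aut_group r)"
    using A.carrier_subgroup_generated_subset by (fastforce simp: rotation_group_def hom_def)
  have "word_eval (rotation_group n r \<Phi>) (sigma n r \<Phi>) w = word_eval (aut_group r) (sigma n r \<Phi>) w"
    using group.word_eval_hom[OF R A.is_group hom sig] w Wplus_relators_words by (auto simp: o_def)
  also have "\<dots> = \<one>\<^bsub>aut_group r\<^esub>"
    using sigma_flag(1)[OF rot \<Phi>] sigma_run_involution[OF rot \<Phi>] w
    by (intro word_eval_relators[OF A.is_group]) auto
  finally show "word_eval (rotation_group n r \<Phi>) (sigma n r \<Phi>) w = \<one>\<^bsub>rotation_group n r \<Phi>\<^esub>"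
    by (simp add: rotation_group_def)
qed

end

section \<open>Chirality groups of mixes\<close>

text \<open>Common setting for the rotation groups of both polytopes and of the mix: the relations
  make \<open>pres_hom G s\<close> a homomorphism from \<open>Wplus n\<close>.\<close>

locale Wplus_quotient = group G for n :: nat and G (structure) and s +
  assumes generators: "s \<in> {1..<n} \<rightarrow> carrier G"
    and relators: "w \<in> Wplus_relators n \<Longrightarrow> word_eval G s w = \<one>"
begin

lemma hom: "pres_hom G s \<in> hom (Wplus n) G"
  unfolding Wplus_def by (rule pres_hom_hom[OF generators Wplus_relators_words relators])

lemma pres_hom_class:
  "u \<in> words {1..<n} \<Longrightarrow> pres_hom G s (word_class {1..<n} (Wplus_relators n) u) = word_eval G s u"
  by (rule pres_hom_word_class[OF generators Wplus_relators_words relators])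

lemma subgroup_kernel: "subgroup (Wplus_kernel n G s) (Wplus n)"
  unfolding Wplus_kernel_def
  using hom group_Wplus is_group
  by (intro group_hom.subgroup_kernel) (simp add: group_hom_def group_hom_axioms_def)

text \<open>Brings the chirality group into the form of cosets to which
  \<open>finite_cosets_image_mono_index\<close> applies.\<close>

lemma carrier_chirality_group:
  "carrier (chirality_group n G s) =
    (\<lambda>x. Wplus_kernel n G s #>\<^bsub>Wplus n\<^esub> Wplus_bar n x) ` Wplus_kernel n G s"
proof -
  have "Wplus_bar n ` Wplus_kernel n G s \<subseteq> carrier (Wplus n)"
    using hom_in_carrier[OF Wplus_bar_hom] subgroup.subset[OF subgroup_kernel] by blast
  then show ?thesis
    using group.carrier_set_mult_FactGroup[OF group_Wplus subgroup_kernel]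
    by (simp add: chirality_group_def Let_def image_image)
qed

end

lemma rotation_group_Wplus_quotient:
  assumes "chiral_polytope n r \<or> regular_polytope n r" "\<Phi> \<in> flags r"
  shows "Wplus_quotient n (rotation_group n r \<Phi>) (sigma n r \<Phi>)"
proof -
  interpret polytope n r
    using assms(1) by unfold_locales (auto simp: chiral_polytope_def regular_polytope_def)
  interpret A: group "aut_group r" by (rule group_aut_group)
  have "group (rotation_group n r \<Phi>)" by (simp add: rotation_group_def)
  then show ?thesis
    using rotation_group_relations[OF assms]
    by (simp add: Wplus_quotient_def Wplus_quotient_axioms_def)
qed

text \<open>The mix for arbitrary groups with chosen elements; rotation groups give
  \<open>mix_rotation_group\<close>.\<close>

definition mix_group where
  "mix_group n G s H t = subgroup_generated (G \<times>\<times> H) ((\<lambda>i. (s i, t i)) ` {1..<n})"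

text \<open>The projections are homomorphisms, so words are evaluated componentwise. A word is
  therefore trivial in the mix exactly when it is trivial in both factors.\<close>

lemma
  fixes n :: nat
  assumes "Wplus_quotient n G s" "Wplus_quotient n H t"
  shows Wplus_quotient_mix: "Wplus_quotient n (mix_group n G s H t) (\<lambda>i. (s i, t i))"
    and Wplus_kernel_mix: "Wplus_kernel n (mix_group n G s H t) (\<lambda>i. (s i, t i)) =
      Wplus_kernel n G s \<inter> Wplus_kernel n H t"
proof -
  interpret G: Wplus_quotient n G s by fact
  interpret H: Wplus_quotient n H t by fact
  interpret P: group "G \<times>\<times> H" by (rule DirProd_group) unfold_locales
  let ?M = "mix_group n G s H t" and ?u = "\<lambda>i. (s i, t i)"
  have M: "group ?M" by (simp add: mix_group_def)
  have u: "?u \<in> {1..<n} \<rightarrow> carrier ?M"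
    using G.generators H.generators
    by (auto simp: mix_group_def carrier_subgroup_generated intro!: generate.incl)
  have sub: "carrier ?M \<subseteq> carrier G \<times> carrier H"
    using P.carrier_subgroup_generated_subset by (simp add: mix_group_def DirProd_def)
  have "fst \<in> hom ?M G" "snd \<in> hom ?M H"
    using sub by (auto simp: hom_def mix_group_def mult_DirProd' DirProd_def)
  then have ev: "word_eval ?M ?u w = (word_eval G s w, word_eval H t w)" if "w \<in> words {1..<n}" for w
    using group.word_eval_hom[OF M G.is_group _ u that, of fst]
      group.word_eval_hom[OF M H.is_group _ u that, of snd]
    by (simp add: prod_eq_iff o_def)
  have one: "\<one>\<^bsub>?M\<^esub> = (\<one>\<^bsub>G\<^esub>, \<one>\<^bsub>H\<^esub>)"
    by (simp add: mix_group_def)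
  show mix: "Wplus_quotient n ?M ?u"
  proof (intro Wplus_quotient.intro M Wplus_quotient_axioms.intro u)
    fix w assume "w \<in> Wplus_relators n"
    then show "word_eval ?M ?u w = \<one>\<^bsub>?M\<^esub>"
      using Wplus_relators_words[of n] G.relators H.relators by (simp add: ev one subset_iff)
  qed
  show "Wplus_kernel n ?M ?u = Wplus_kernel n G s \<inter> Wplus_kernel n H t"
    unfolding Wplus_kernel_def kernel_def
    using Wplus_quotient.pres_hom_class[OF mix] G.pres_hom_class H.pres_hom_class
    by (auto simp: Wplus_def carrier_presented_group ev one)
qed

text \<open>By contradiction, with the map onto the second factor in the role of \<open>k\<close> in
  \<open>finite_cosets_image_mono_index\<close>.\<close>

lemma infinite_chirality_group_mix:
  assumes G: "Wplus_quotient n G s" and H: "Wplus_quotient n H t" and fin: "finite (carrier H)"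
    and inf: "infinite (carrier (chirality_group n G s))"
  shows "infinite (carrier (chirality_group n (mix_group n G s H t) (\<lambda>i. (s i, t i))))"
proof
  interpret G: Wplus_quotient n G s by fact
  interpret H: Wplus_quotient n H t by fact
  interpret M: Wplus_quotient n "mix_group n G s H t" "\<lambda>i. (s i, t i)"
    using G H by (rule Wplus_quotient_mix)
  let ?M = "Wplus_kernel n G s" and ?K = "kernel (Wplus n) H (pres_hom H t)"
  assume "finite (carrier (chirality_group n (mix_group n G s H t) (\<lambda>i. (s i, t i))))"
  then have "finite ((\<lambda>x. (?M \<inter> ?K) #>\<^bsub>Wplus n\<^esub> Wplus_bar n x) ` (?M \<inter> ?K))"
    by (simp add: M.carrier_chirality_group Wplus_kernel_mix[OF G H] Wplus_kernel_def[of n H t])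
  \<comment> \<open>This expresses that \<open>?M \<inter> ?K\<close> has finite index in
    \<open>?M\<close>.\<close>
  moreover have "finite (pres_hom H t ` ?M)"
    using hom_in_carrier[OF H.hom] subgroup.subset[OF G.subgroup_kernel] fin
    by (intro finite_subset[OF _ fin]) blast
  ultimately have "finite ((\<lambda>x. ?M #>\<^bsub>Wplus n\<^esub> Wplus_bar n x) ` ?M)"
    using G.subgroup_kernel Wplus_bar_hom H.hom H.is_group
    by (intro group.finite_cosets_image_mono_index[OF group_Wplus]) auto
  then show False
    using inf by (simp add: G.carrier_chirality_group)
qed

theorem theorem4p9:
  fixes P :: "'a rel" and Q :: "'b rel" and n :: nat and \<Phi> :: "'a set" and \<Psi> :: "'b set"
  assumes "chiral_polytope n P" and "\<Phi> \<in> flags P"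
    and "infinite (carrier (polytope_chirality_group n P \<Phi>))"
    and "chiral_polytope n Q \<or> directly_regular_polytope n Q" and "finite (Field Q)"
    and "\<Psi> \<in> flags Q"
  shows "infinite (carrier (mix_chirality_group n P \<Phi> Q \<Psi>))"
proof -
  have P: "Wplus_quotient n (rotation_group n P \<Phi>) (sigma n P \<Phi>)"
    using assms(1,2) by (simp add: rotation_group_Wplus_quotient)
  have Q: "Wplus_quotient n (rotation_group n Q \<Psi>) (sigma n Q \<Psi>)"
    using assms(4,6) by (auto simp: directly_regular_polytope_def intro: rotation_group_Wplus_quotient)
  \<comment> \<open>Finitely many faces of \<open>Q\<close> give a finite automorphism group and
    hence a finite rotation group.\<close>
  have "carrier (rotation_group n Q \<Psi>) \<subseteq> carrier (aut_group Q)"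
    unfolding rotation_group_def by (rule group.carrier_subgroup_generated_subset[OF group_aut_group])
  then have fin: "finite (carrier (rotation_group n Q \<Psi>))"
    using finite_aut_group[OF assms(5)] by (rule finite_subset)
  have "infinite (carrier (chirality_group n (rotation_group n P \<Phi>) (sigma n P \<Phi>)))"
    using assms(3) by (simp add: polytope_chirality_group_def)
  from infinite_chirality_group_mix[OF P Q fin this] show ?thesis
    by (simp add: mix_chirality_group_def mix_rotation_group_def mix_group_def
        mix_sigma_def[abs_def])
qed

end
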